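(* For each $p\in(2/3,1]$ and each finite set $\Lambda\subset\mathbb{Z}^2$ of sites there exist constants $C_\Lambda,\alpha_\Lambda>0$ such that for any two configurations $\zeta^\Lambda,\eta^\Lambda\in\{0,1\}^\Lambda$ and for all $t>0$, $$\left|P_p^{\nu_p}\{\xi_t^\Lambda=\zeta^\Lambda;\ \xi_0^\Lambda=\eta^\Lambda\}-\nu_p^\Lambda(\zeta^\Lambda)\,\nu_p^\Lambda(\eta^\Lambda)\right|\le C_\Lambda\exp\{-\alpha_\Lambda t\}.$$
   Context: Northeast model with flip parameter $p$: the Feller Markov process $(\xi_t)_{t\ge 0}$ on the configuration space $X=\{0,1\}^{\mathbb{Z}^2}$ (product topology) in which the spin at site $(x,y)\in\mathbb{Z}^2$ may flip only at times when the spins at the westerly neighbor $(x-1,y)$ and the southerly neighbor $(x,y-1)$ are both $1$; at such times the flip rates are $0\to 1$ at rate $p$ and $1\to 0$ at rate $1-p$. Equivalently, its generator is the closure of the operator defined on functions $f:X\to\mathbb{R}$ depending on finitely many coordinates by $\mathcal{L}f(\sigma)=\sum_{x}\nabla_x f(\sigma)\mathbf{1}\{x\in A(\sigma)\}$, where $A(\sigma)$ is the set of sites whose southerly and westerly nearest neighbors both have spin $1$ in $\sigma$, $\nabla_xf(\sigma)=p\,(f(\sigma_x^+)-f(\sigma_x^-))$ if $\sigma(x)=0$, $\nabla_xf(\sigma)=(1-p)(f(\sigma_x^-)-f(\sigma_x^+))$ if $\sigma(x)=1$, and $\sigma_x^{+},\sigma_x^-$ agree with $\sigma$ off $x$ and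 have spin $1$, respectively $0$, at $x$. $\nu_p$ denotes the product Bernoulli-$p$ measure on $X$, and $P_p^{\nu_p}$ is the law of the process with initial configuration $\xi_0$ chosen at random from $\nu_p$. For $\Lambda\subset\mathbb{Z}^2$, $\xi_t^\Lambda$ denotes the restriction of $\xi_t$ to $\Lambda$, and $\nu_p^\Lambda$ the product Bernoulli-$p$ measure on $\{0,1\}^\Lambda$. *)

theory Defs
  imports "HOL-Probability.Probability"
begin

type_synonym site = "int \<times> int"

text \<open>Spin 1 is \<open>True\<close>, spin 0 is \<open>False\<close>. As \<open>bool\<close> carries the discrete topology, the
  topology on \<open>config\<close> is the compact product topology; hence \<open>config \<Rightarrow>\<^sub>C real\<close>, with its
  supremum norm, is the space of all real continuous functions on configurations.\<close>

type_synonym config = "site \<Rightarrow> bool"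

definition allowed_sites :: "config \<Rightarrow> site set" where
  "allowed_sites \<sigma> = {(x, y). \<sigma> (x - 1, y) \<and> \<sigma> (x, y - 1)}"

definition flip_gradient :: "real \<Rightarrow> site \<Rightarrow> (config \<Rightarrow> real) \<Rightarrow> config \<Rightarrow> real" where
  "flip_gradient p x f \<sigma> =
     (if \<sigma> x then (1 - p) * (f (\<sigma>(x := False)) - f (\<sigma>(x := True)))
      else p * (f (\<sigma>(x := True)) - f (\<sigma>(x := False))))"

definition cylinder :: "(config \<Rightarrow> real) \<Rightarrow> bool" where
  "cylinder f \<longleftrightarrow>
     (\<exists>F. finite F \<and> (\<forall>\<sigma> \<tau>. (\<forall>x\<in>F. \<sigma> x = \<tau> x) \<longrightarrow> f \<sigma> = f \<tau>))"

text \<open>For a cylinder function only finitely many terms of this sum are nonzero.\<close>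

definition northeast_pregenerator :: "real \<Rightarrow> (config \<Rightarrow> real) \<Rightarrow> config \<Rightarrow> real" where
  "northeast_pregenerator p f \<sigma> =
     (\<Sum>\<^sub>\<infinity>x. flip_gradient p x f \<sigma> * indicator (allowed_sites \<sigma>) x)"

text \<open>Unbounded operators are represented by their graphs.\<close>

definition northeast_pregenerator_graph ::
    "real \<Rightarrow> ((config \<Rightarrow>\<^sub>C real) \<times> (config \<Rightarrow>\<^sub>C real)) set" where
  "northeast_pregenerator_graph p =
     {(f, g). cylinder (apply_bcontfun f) \<and>
       (\<forall>\<sigma>. apply_bcontfun g \<sigma> = northeast_pregenerator p (apply_bcontfun f) \<sigma>)}"

definition feller_semigroup ::
    "(real \<Rightarrow> (config \<Rightarrow>\<^sub>C real) \<Rightarrow> (config \<Rightarrow>\<^sub>C real)) \<Rightarrow> bool" where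
  "feller_semigroup S \<longleftrightarrow>
     (\<forall>t\<ge>0. linear (S t)) \<and>
     (\<forall>t\<ge>0. \<forall>f. (\<forall>\<sigma>. 0 \<le> apply_bcontfun f \<sigma>) \<longrightarrow> (\<forall>\<sigma>. 0 \<le> apply_bcontfun (S t f) \<sigma>)) \<and>
     (\<forall>t\<ge>0. S t (const_bcontfun 1) = const_bcontfun 1) \<and>
     (\<forall>f. S 0 f = f) \<and>
     (\<forall>s\<ge>0. \<forall>t\<ge>0. \<forall>f. S (s + t) f = S s (S t f)) \<and>
     (\<forall>f. ((\<lambda>t. S t f) \<longlongrightarrow> f) (at_right 0))"

definition generator_graph ::
    "(real \<Rightarrow> (config \<Rightarrow>\<^sub>C real) \<Rightarrow> (config \<Rightarrow>\<^sub>C real)) \<Rightarrow>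
      ((config \<Rightarrow>\<^sub>C real) \<times> (config \<Rightarrow>\<^sub>C real)) set" where
  "generator_graph S =
     {(f, g). ((\<lambda>t. (1 / t) *\<^sub>R (S t f - f)) \<longlongrightarrow> g) (at_right 0)}"

definition northeast_semigroup ::
    "real \<Rightarrow> (real \<Rightarrow> (config \<Rightarrow>\<^sub>C real) \<Rightarrow> (config \<Rightarrow>\<^sub>C real)) \<Rightarrow> bool" where
  "northeast_semigroup p S \<longleftrightarrow>
     feller_semigroup S \<and> generator_graph S = closure (northeast_pregenerator_graph p)"

text \<open>Since there are countably many sites, this product \<open>\<sigma>\<close>-algebra is the Borel
  \<open>\<sigma>\<close>-algebra of the product topology.\<close>

definition config_space :: "config measure" where
  "config_space = (\<Pi>\<^sub>M x\<in>UNIV. count_space UNIV)"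

definition bernoulli_product :: "real \<Rightarrow> site set \<Rightarrow> config measure" where
  "bernoulli_product p \<Lambda> = (\<Pi>\<^sub>M x\<in>\<Lambda>. measure_pmf (bernoulli_pmf p))"

definition path_space :: "real set \<Rightarrow> (real \<Rightarrow> config) measure" where
  "path_space T = (\<Pi>\<^sub>M t\<in>T. config_space)"

text \<open>The \<open>\<sigma>\<close>-algebra generated by the coordinates at times in \<open>{0..s}\<close>.\<close>

definition past :: "real \<Rightarrow> (real \<Rightarrow> config) measure" where
  "past s = vimage_algebra (space (path_space {0..})) (\<lambda>\<omega>. restrict \<omega> {0..s}) (path_space {0..s})"

text \<open>\<open>Q\<close> is the law, on the space of all paths indexed by \<open>{0..}\<close>, of a Markov process with
  initial distribution \<open>\<mu>\<close> and transition semigroup \<open>S\<close>. The coordinate \<open>\<omega> t\<close> is the state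
  at time \<open>t\<close>.\<close>

definition markov_law ::
    "(real \<Rightarrow> (config \<Rightarrow>\<^sub>C real) \<Rightarrow> (config \<Rightarrow>\<^sub>C real)) \<Rightarrow> config measure \<Rightarrow>
      (real \<Rightarrow> config) measure \<Rightarrow> bool" where
  "markov_law S \<mu> Q \<longleftrightarrow>
     prob_space Q \<and> sets Q = sets (path_space {0..}) \<and>
     distr Q config_space (\<lambda>\<omega>. \<omega> 0) = \<mu> \<and>
     (\<forall>s\<ge>0. \<forall>t\<ge>0. \<forall>f. AE \<omega> in Q.
        real_cond_exp Q (past s) (\<lambda>\<omega>. apply_bcontfun f (\<omega> (s + t))) \<omega> =
          apply_bcontfun (S t f) (\<omega> s))"

definition northeast_law :: "real \<Rightarrow> config measure \<Rightarrow> (real \<Rightarrow> config) measure \<Rightarrow> bool" where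
  "northeast_law p \<mu> Q \<longleftrightarrow> (\<exists>S. northeast_semigroup p S \<and> markov_law S \<mu> Q)"

end

theory Submission
  imports Defs "HOL-Library.Function_Algebras"
begin

text \<open>The product measure is reversible, so it is enough to prove a Poincare inequality
  (spectral gap) for the generator: then the variance of \<open>S t f\<close> decays exponentially and
  Cauchy--Schwarz against the indicator of the initial pattern gives the claim, even with constants
  that do not depend on \<open>\<Lambda>\<close>.

  For the Poincare inequality write \<open>E\<^bsub>D\<^esub>\<close> for averaging over the spins in \<open>D\<close> and order the sites
  by the antidiagonals \<open>x + y = const\<close>. Then \<open>Var f\<close> is the sum over \<open>x\<close> of the squared norms of
  \<open>(1 - E\<^bsub>x\<^esub>) E\<^bsub>B\<^esub> f\<close>, where \<open>B\<close> is the set of sites before \<open>x\<close>. Let \<open>C\<close> be the indicator that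
  the west and south neighbours of \<open>x\<close> are both 1 or can be made so by one legal flip each. It
  depends only on a set \<open>D \<subseteq> B\<close> of five sites on the two preceding antidiagonals, and
  \<open>P := E\<^bsub>D\<^esub> C > 2/3\<close> as soon as \<open>p \<ge> 2/3\<close>. In
  \<open>P E\<^bsub>B\<^esub> u = E\<^bsub>B\<^esub> (C u) - E\<^bsub>B\<^esub> ((C - P) u)\<close> with \<open>u = (1 - E\<^bsub>x\<^esub>) f\<close> the first term is controlled by the
  Dirichlet form, while the second has squared norm at most \<open>P (1 - P)\<close> times that of
  \<open>(1 - E\<^bsub>D\<^esub>) E\<^bsub>B - D\<^esub> u\<close>. The latter splits along the two antidiagonals, and on each of them the
  projections for different \<open>x\<close> are orthogonal; so their sum over \<open>x\<close> is at most \<open>2 Var f\<close>, and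
  \<open>2 P (1 - P) < P\<^sup>2\<close> allows to absorb it.\<close>

section \<open>Cylinder functions and partial averages\<close>

declare plus_fun_apply [simp del] times_fun_apply [simp del] minus_apply [simp del]
  zero_fun_apply [simp del]
  split_paired_All [simp del] split_paired_Ex [simp del]

lemmas pointwise = plus_fun_apply times_fun_apply minus_apply zero_fun_apply

definition depends_on :: "site set \<Rightarrow> (config \<Rightarrow> 'a) \<Rightarrow> bool" where
  "depends_on F f \<longleftrightarrow> (\<forall>\<sigma> \<tau>. (\<forall>x\<in>F. \<sigma> x = \<tau> x) \<longrightarrow> f \<sigma> = f \<tau>)"

lemma cylinder_iff: "cylinder f \<longleftrightarrow> (\<exists>F. finite F \<and> depends_on F f)"
  by (simp add: cylinder_def depends_on_def)

lemma depends_onD: "depends_on F f \<Longrightarrow> (\<And>x. x \<in> F \<Longrightarrow> \<sigma> x = \<tau> x) \<Longrightarrow> f \<sigma> = f \<tau>"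
  by (auto simp: depends_on_def)

lemma depends_on_mono: "depends_on F f \<Longrightarrow> F \<subseteq> G \<Longrightarrow> depends_on G f"
  by (auto simp: depends_on_def subset_eq)

lemma depends_on_upd: "depends_on F f \<Longrightarrow> x \<notin> F \<Longrightarrow> f (\<sigma>(x := b)) = f \<sigma>"
  by (rule depends_onD) auto

lemma depends_on_minus: "depends_on F f \<Longrightarrow> depends_on F g \<Longrightarrow> depends_on F (f - g)"
  and depends_on_times: "depends_on F f \<Longrightarrow> depends_on F g \<Longrightarrow> depends_on F (f * g)"
  for f g :: "config \<Rightarrow> real"
  unfolding depends_on_def fun_diff_def times_fun_def by metis+

lemma depends_on_UNIV [simp]: "depends_on UNIV f"
  unfolding depends_on_def by (intro allI impI arg_cong[where f=f] ext) simp

lemma depends_on_const: "depends_on F (\<lambda>_. c)"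
  by (simp add: depends_on_def)

lemma cylinder_binop:
  assumes "cylinder f" "cylinder g" shows "cylinder (\<lambda>\<sigma>. h (f \<sigma>) (g \<sigma>))"
proof -
  obtain F G where "finite F" "depends_on F f" "finite G" "depends_on G g"
    using assms by (auto simp: cylinder_iff)
  then have "finite (F \<union> G)" "depends_on (F \<union> G) f" "depends_on (F \<union> G) g"
    by (auto intro: depends_on_mono)
  then show ?thesis unfolding cylinder_def depends_on_def by metis
qed

lemma cylinder_plus [intro!]: "cylinder f \<Longrightarrow> cylinder g \<Longrightarrow> cylinder (f + g)"
  and cylinder_minus [intro!]: "cylinder f \<Longrightarrow> cylinder g \<Longrightarrow> cylinder (f - g)"
  and cylinder_times [intro!]: "cylinder f \<Longrightarrow> cylinder g \<Longrightarrow> cylinder (f * g)"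
  by (simp_all add: plus_fun_def fun_diff_def times_fun_def cylinder_binop)

lemma cylinder_const [intro!]: "cylinder (\<lambda>_. c)"
  by (auto simp: cylinder_def)

lemma cylinder_zero [intro!]: "cylinder 0"
  by (auto simp: cylinder_def zero_fun_apply)

lemma cylinder_scale [intro!]: "cylinder f \<Longrightarrow> cylinder (\<lambda>\<sigma>. c * f \<sigma>)"
  unfolding cylinder_def by metis

lemma cylinder_sum [intro!]: "(\<And>i. i \<in> A \<Longrightarrow> cylinder (f i)) \<Longrightarrow> cylinder (sum f A)"
  by (induction A rule: infinite_finite_induct) auto

lemma sum_fun_apply: "sum f A \<sigma> = (\<Sum>i\<in>A. f i \<sigma>)" for f :: "'i \<Rightarrow> 'b \<Rightarrow> real"
  by (induction A rule: infinite_finite_induct) (auto simp: plus_fun_apply zero_fun_apply)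

lemma cylinder_finite_range:
  assumes "cylinder f" shows "finite (range f)"
proof -
  obtain F where F: "finite F" "depends_on F f" using assms by (auto simp: cylinder_iff)
  have "range f \<subseteq> f ` (\<lambda>A x. x \<in> A) ` Pow F"
  proof safe
    fix \<sigma>
    have "f \<sigma> = f (\<lambda>x. x \<in> {x\<in>F. \<sigma> x})" by (rule depends_onD[OF F(2)]) auto
    then show "f \<sigma> \<in> f ` (\<lambda>A x. x \<in> A) ` Pow F" by blast
  qed
  then show ?thesis by (rule finite_subset) (simp add: F)
qed

lemma cylinder_bounded:
  assumes "cylinder f" obtains B where "\<And>\<sigma>. \<bar>f \<sigma>\<bar> \<le> B"
proof -
  have "bounded (range f)" using cylinder_finite_range[OF assms] by (rule finite_imp_bounded)
  then show ?thesis by (auto simp: bounded_iff intro: that)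
qed

lemma depends_on_measurable:
  assumes F: "finite F" "depends_on F f" and FJ: "F \<subseteq> J"
  shows "f \<in> borel_measurable (\<Pi>\<^sub>M x\<in>J. count_space UNIV)" (is "_ \<in> borel_measurable ?M")
proof -
  have "(\<lambda>\<sigma>. {x\<in>F. \<sigma> x}) \<in> measurable ?M (count_space (Pow F))"
  proof (rule measurable_count_space_eq2[THEN iffD2])
    show "finite (Pow F)" using F by simp
    have "(\<lambda>\<sigma>. {x \<in> F. \<sigma> x}) -` {A} \<inter> space ?M \<in> sets ?M" if "A \<subseteq> F" for A
    proof -
      have "{\<sigma>\<in>space ?M. \<sigma> x = (x \<in> A)} \<in> sets ?M" if "x \<in> F" for x
      proof -
        have "(\<lambda>\<sigma>. \<sigma> x) \<in> ?M \<rightarrow>\<^sub>M count_space UNIV"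
          using that FJ by (intro measurable_component_singleton) auto
        from measurable_sets[OF this, of "{x \<in> A}"] show ?thesis
          by (simp add: vimage_def Int_def conj_commute)
      qed
      then have "{\<sigma>\<in>space ?M. \<forall>x\<in>F. \<sigma> x = (x \<in> A)} \<in> sets ?M"
        using F(1) by (intro sets.sets_Collect_finite_All) auto
      also have "{\<sigma>\<in>space ?M. \<forall>x\<in>F. \<sigma> x = (x \<in> A)} =
          (\<lambda>\<sigma>. {x \<in> F. \<sigma> x}) -` {A} \<inter> space ?M" using that by auto
      finally show ?thesis .
    qed
    then show "(\<lambda>\<sigma>. {x \<in> F. \<sigma> x}) \<in> space ?M \<rightarrow> Pow F \<and>
      (\<forall>A\<in>Pow F. (\<lambda>\<sigma>. {x \<in> F. \<sigma> x}) -` {A} \<inter> space ?M \<in> sets ?M)"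
      by auto
  qed
  from measurable_compose[OF this, of "\<lambda>A. f (\<lambda>x. x \<in> A)" borel]
  have "(\<lambda>\<sigma>. f (\<lambda>x. x \<in> F \<and> \<sigma> x)) \<in> borel_measurable ?M" by simp
  moreover have "f \<sigma> = f (\<lambda>x. x \<in> F \<and> \<sigma> x)" for \<sigma>
    by (rule depends_onD[OF F(2)]) auto
  ultimately show ?thesis by simp
qed

lemma cylinder_measurable: "cylinder f \<Longrightarrow> f \<in> borel_measurable config_space"
  unfolding config_space_def cylinder_iff by (blast intro: depends_on_measurable)

lemma depends_on_continuous:
  assumes "finite F" "depends_on F f"
  shows "continuous_on UNIV (f :: config \<Rightarrow> real)"
proof -
  have "open (f -` B)" for B
  proof (subst open_subopen, safe)
    fix \<sigma> assume "f \<sigma> \<in> B"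
    have "open {\<tau>. \<forall>x\<in>F. \<tau> (id x) \<in> {\<sigma> x}}"
      by (rule product_topology_basis') (fact assms(1), rule Topological_Spaces.open_discrete)
    then have "open {\<tau>. \<forall>x\<in>F. \<tau> x \<in> {\<sigma> x}}" by simp
    moreover have "{\<tau>. \<forall>x\<in>F. \<tau> x \<in> {\<sigma> x}} \<subseteq> f -` B"
    proof
      fix \<tau> assume "\<tau> \<in> {\<tau>. \<forall>x\<in>F. \<tau> x \<in> {\<sigma> x}}"
      then have "f \<tau> = f \<sigma>" by (intro depends_onD[OF assms(2)]) simp
      with \<open>f \<sigma> \<in> B\<close> show "\<tau> \<in> f -` B" by simp
    qed
    ultimately show "\<exists>T. open T \<and> \<sigma> \<in> T \<and> T \<subseteq> f -` B" by blast
  qed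
  then show ?thesis by (simp add: continuous_on_open_vimage)
qed

lemma cylinder_bcontfun: "cylinder f \<Longrightarrow> f \<in> bcontfun"
  using depends_on_continuous finite_imp_bounded[OF cylinder_finite_range]
  by (auto simp: bcontfun_def cylinder_iff)

locale spin_bias =
  fixes p :: real
  assumes bias_nonneg: "0 \<le> p" and bias_le_1: "p \<le> 1"
begin

definition site_mean :: "site \<Rightarrow> (config \<Rightarrow> real) \<Rightarrow> config \<Rightarrow> real" where
  "site_mean x f = (\<lambda>\<sigma>. p * f (\<sigma>(x := True)) + (1 - p) * f (\<sigma>(x := False)))"

definition mean :: "site set \<Rightarrow> (config \<Rightarrow> real) \<Rightarrow> config \<Rightarrow> real" where
  "mean D f = Finite_Set.fold site_mean f D"

lemma site_mean_commute: "site_mean x (site_mean y f) = site_mean y (site_mean x f)"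
proof (cases "x = y")
  case False
  then show ?thesis
    by (auto simp: site_mean_def fun_eq_iff algebra_simps fun_upd_twist[OF False])
qed simp

lemma site_mean_depends_on: "depends_on F f \<Longrightarrow> depends_on (F - {x}) (site_mean x f)"
  unfolding depends_on_def site_mean_def
  by (intro allI impI arg_cong2[where f="(+)"] arg_cong2[where f="(*)"]) auto

lemma site_mean_module:
  assumes "depends_on F h" "x \<notin> F"
  shows "site_mean x (h * f) = h * site_mean x f"
  using assms by (auto simp: site_mean_def fun_eq_iff pointwise depends_on_upd algebra_simps)

lemma site_mean_trivial: "depends_on F f \<Longrightarrow> x \<notin> F \<Longrightarrow> site_mean x f = f"
  by (auto simp: site_mean_def fun_eq_iff pointwise depends_on_upd algebra_simps)

lemma site_mean_idem: "site_mean x (site_mean x f) = site_mean x f"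
  by (rule site_mean_trivial[OF site_mean_depends_on[of UNIV]]) auto

sublocale fold_site_mean: comp_fun_idem site_mean
proof
  show "site_mean y \<circ> site_mean x = site_mean x \<circ> site_mean y" for x y
    by (rule ext, simp only: o_apply, rule site_mean_commute)
  show "site_mean x \<circ> site_mean x = site_mean x" for x
    by (rule ext) (simp add: site_mean_idem)
qed

lemma mean_empty [simp]: "mean {} f = f"
  by (simp add: mean_def)

lemma mean_insert: "finite D \<Longrightarrow> mean (insert x D) f = site_mean x (mean D f)"
  by (simp add: mean_def)

lemma mean_singleton: "mean {x} f = site_mean x f"
  by (simp add: mean_insert)

lemma mean_mean: "finite A \<Longrightarrow> finite B \<Longrightarrow> mean A (mean B f) = mean (A \<union> B) f"
  by (induction A rule: finite_induct) (auto simp: mean_insert)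

lemma mean_depends_on:
  "finite D \<Longrightarrow> depends_on F f \<Longrightarrow> depends_on (F - D) (mean D f)"
proof (induction D rule: finite_induct)
  case (insert x D)
  have "F - insert x D = F - D - {x}" by blast
  with insert show ?case using site_mean_depends_on[of "F - D" "mean D f" x]
    by (simp add: mean_insert)
qed simp

lemma mean_depends_on_compl: "finite D \<Longrightarrow> depends_on (- D) (mean D f)"
  using mean_depends_on[of D UNIV f] by (simp add: Compl_eq_Diff_UNIV)

lemma mean_module: "finite D \<Longrightarrow> depends_on (- D) h \<Longrightarrow> mean D (h * f) = h * mean D f"
proof (induction D rule: finite_induct)
  case (insert x D)
  then have "depends_on (- D) h" by (auto intro: depends_on_mono)
  with insert show ?case by (simp add: mean_insert site_mean_module[of "- insert x D"])
qed simp

lemma mean_trivial: "finite D \<Longrightarrow> depends_on (- D) f \<Longrightarrow> mean D f = f"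
proof (induction D rule: finite_induct)
  case (insert x D)
  then have "depends_on (- D) f" by (auto intro: depends_on_mono)
  with insert show ?case by (simp add: mean_insert site_mean_trivial[of "- insert x D"])
qed simp

lemma mean_plus: "finite D \<Longrightarrow> mean D (f + g) = mean D f + mean D g"
  by (induction D rule: finite_induct)
    (auto simp: mean_insert site_mean_def fun_eq_iff pointwise algebra_simps)

lemma mean_minus: "finite D \<Longrightarrow> mean D (f - g) = mean D f - mean D g"
  using mean_plus[of D "f - g" g] by (simp add: algebra_simps)

lemma mean_const: "finite D \<Longrightarrow> mean D (\<lambda>_. c) = (\<lambda>_. c)"
  by (rule mean_trivial) (auto simp: depends_on_def)

lemma mean_zero: "finite D \<Longrightarrow> mean D 0 = 0"
  using mean_const[of D 0] by (simp add: zero_fun_def)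

lemma mean_scale: "finite D \<Longrightarrow> mean D (\<lambda>\<sigma>. c * f \<sigma>) = (\<lambda>\<sigma>. c * mean D f \<sigma>)"
  using mean_module[of D "\<lambda>_. c" f] by (simp add: depends_on_const times_fun_def)

lemma mean_mono: "finite D \<Longrightarrow> (\<And>\<sigma>. f \<sigma> \<le> g \<sigma>) \<Longrightarrow> mean D f \<sigma> \<le> mean D g \<sigma>"
proof (induction D arbitrary: \<sigma> rule: finite_induct)
  case (insert x D)
  then show ?case using bias_nonneg bias_le_1
    by (auto simp: mean_insert site_mean_def intro!: add_mono mult_left_mono)
qed simp

lemma mean_nonneg: "finite D \<Longrightarrow> (\<And>\<sigma>. 0 \<le> f \<sigma>) \<Longrightarrow> 0 \<le> mean D f \<sigma>"
  using mean_mono[of D "\<lambda>_. 0" f \<sigma>] by (simp add: mean_const)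

lemma cylinder_mean [intro!]: "finite D \<Longrightarrow> cylinder f \<Longrightarrow> cylinder (mean D f)"
  unfolding cylinder_iff by (metis finite_Diff mean_depends_on)

lemma mean_Cauchy_Schwarz:
  assumes D: "finite D"
  shows "(mean D (h * g) \<sigma>)\<^sup>2 \<le> mean D (h * h) \<sigma> * mean D (g * g) \<sigma>"
proof -
  define a b c where "a = mean D (h * h) \<sigma>" and "b = mean D (h * g) \<sigma>" and "c = mean D (g * g) \<sigma>"
  have quad: "0 \<le> s * s * a + 2 * s * t * b + t * t * c" for s t
  proof -
    have "(\<lambda>\<sigma>. (s * h \<sigma> + t * g \<sigma>)\<^sup>2) =
        (\<lambda>\<sigma>. s * s * (h * h) \<sigma>) + ((\<lambda>\<sigma>. 2 * s * t * (h * g) \<sigma>) + (\<lambda>\<sigma>. t * t * (g * g) \<sigma>))"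
      by (auto simp: fun_eq_iff pointwise power2_eq_square algebra_simps)
    then have "mean D (\<lambda>\<sigma>. (s * h \<sigma> + t * g \<sigma>)\<^sup>2) \<sigma> = s * s * a + 2 * s * t * b + t * t * c"
      unfolding a_def b_def c_def by (simp only: mean_plus mean_scale D plus_fun_apply add.assoc)
    then show ?thesis using mean_nonneg[OF D, of "\<lambda>\<sigma>. (s * h \<sigma> + t * g \<sigma>)\<^sup>2" \<sigma>] by simp
  qed
  have ac: "0 \<le> a" "0 \<le> c" using quad[of 1 0] quad[of 0 1] by auto
  show ?thesis
  proof (cases "c = 0")
    case True
    have "b = 0"
    proof (rule ccontr)
      assume "b \<noteq> 0"
      then have "a + 2 * (- (a + 1) / (2 * b)) * b = - 1" by (simp add: field_simps)
      then show False using quad[of 1 "- (a + 1) / (2 * b)"] True by simp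
    qed
    then show ?thesis using ac by (simp add: a_def b_def c_def)
  next
    case False
    have "0 \<le> c * (a * c - b * b)" using quad[of c "- b"] by (simp add: algebra_simps)
    then have "0 \<le> a * c - b * b" using False ac(2) by (simp add: zero_le_mult_iff)
    then show ?thesis by (simp add: a_def b_def c_def power2_eq_square)
  qed
qed

end

section \<open>Hilbert space structure\<close>

context spin_bias
begin

abbreviation equilibrium :: "config measure" where
  "equilibrium \<equiv> bernoulli_product p UNIV"

definition expect :: "(config \<Rightarrow> real) \<Rightarrow> real" where
  "expect f = (\<integral>\<sigma>. f \<sigma> \<partial>equilibrium)"

lemma sets_bernoulli_product: "sets (bernoulli_product p J) = sets (\<Pi>\<^sub>M x\<in>J. count_space UNIV)"
  unfolding bernoulli_product_def by (rule sets_PiM_cong) auto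

lemma sets_equilibrium [measurable_cong]: "sets equilibrium = sets config_space"
  by (simp add: sets_bernoulli_product config_space_def)

sublocale spins: product_prob_space "\<lambda>_::site. measure_pmf (bernoulli_pmf p)" UNIV
  by (simp add: product_prob_space_def product_prob_space_axioms_def product_sigma_finite_def
    measure_pmf.prob_space_axioms prob_space_imp_sigma_finite)

lemma prob_space_bernoulli_product: "prob_space (bernoulli_product p J)"
  unfolding bernoulli_product_def by (intro prob_space_PiM measure_pmf.prob_space_axioms)

sublocale equilibrium: prob_space equilibrium
  by (rule prob_space_bernoulli_product)

lemma integrable_depends_on:
  assumes "finite F" "depends_on F f" "F \<subseteq> J"
  shows "integrable (bernoulli_product p J) (f :: config \<Rightarrow> real)"
proof -
  interpret prob_space "bernoulli_product p J" by (rule prob_space_bernoulli_product)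
  obtain B where B: "\<bar>f \<sigma>\<bar> \<le> B" for \<sigma>
    using cylinder_bounded[of f] assms by (auto simp: cylinder_iff)
  have "f \<in> borel_measurable (bernoulli_product p J)"
    using depends_on_measurable[OF assms] measurable_cong_sets[OF sets_bernoulli_product refl] by blast
  then show ?thesis by (intro integrable_const_bound[where B=B]) (auto simp: B)
qed

lemma integrable_cylinder [simp, intro]: "cylinder f \<Longrightarrow> integrable equilibrium f"
  by (auto simp: cylinder_iff intro: integrable_depends_on)

lemma expect_eq_finite_product:
  assumes "finite J" "depends_on J f"
  shows "expect f = (\<integral>\<sigma>. f \<sigma> \<partial>bernoulli_product p J)"
proof -
  have meas: "f \<in> borel_measurable (bernoulli_product p J)"
    using integrable_depends_on[OF assms order_refl] by (rule borel_measurable_integrable)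
  have restr: "(\<lambda>\<sigma>. restrict \<sigma> J) \<in> equilibrium \<rightarrow>\<^sub>M bernoulli_product p J"
    unfolding bernoulli_product_def by (rule measurable_restrict_subset) simp
  have "(\<integral>\<sigma>. f \<sigma> \<partial>bernoulli_product p J) =
      (\<integral>\<sigma>. f \<sigma> \<partial>distr equilibrium (bernoulli_product p J) (\<lambda>\<sigma>. restrict \<sigma> J))"
    unfolding bernoulli_product_def by (subst spins.distr_PiM_restrict_finite) (use assms in auto)
  also have "\<dots> = (\<integral>\<sigma>. f (restrict \<sigma> J) \<partial>equilibrium)"
    by (rule integral_distr[OF restr meas])
  also have "\<dots> = expect f" unfolding expect_def
    by (intro Bochner_Integration.integral_cong refl depends_onD[OF assms(2)]) simp
  finally show ?thesis by simp
qed

lemma expect_site_mean: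
  assumes "cylinder f" shows "expect (site_mean x f) = expect f"
proof -
  obtain F where F: "finite F" "depends_on F f" using assms by (auto simp: cylinder_iff)
  define I where "I = F - {x}"
  have I: "finite I" "x \<notin> I" "depends_on (insert x I) f" "depends_on I (site_mean x f)"
    using F site_mean_depends_on[OF F(2), of x] by (auto simp: I_def intro: depends_on_mono)
  have "integrable (Pi\<^sub>M (insert x I) (\<lambda>_. measure_pmf (bernoulli_pmf p))) f"
    using integrable_depends_on[OF _ I(3) order_refl] I(1) by (simp add: bernoulli_product_def)
  then have "(\<integral>\<sigma>. f \<sigma> \<partial>bernoulli_product p (insert x I)) =
      (\<integral>\<sigma>. (\<integral>b. f (\<sigma>(x := b)) \<partial>bernoulli_pmf p) \<partial>bernoulli_product p I)"
    using I unfolding bernoulli_product_def by (intro spins.product_integral_insert)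
  also have "\<dots> = (\<integral>\<sigma>. site_mean x f \<sigma> \<partial>bernoulli_product p I)"
    using bias_nonneg bias_le_1 by (simp add: site_mean_def mult.commute)
  finally show ?thesis
    using I expect_eq_finite_product[of "insert x I" f] expect_eq_finite_product[of I "site_mean x f"] by simp
qed

lemma expect_mean: "finite D \<Longrightarrow> cylinder f \<Longrightarrow> expect (mean D f) = expect f"
  by (induction D rule: finite_induct) (auto simp: mean_insert expect_site_mean cylinder_mean)

lemma expect_plus: "cylinder f \<Longrightarrow> cylinder g \<Longrightarrow> expect (f + g) = expect f + expect g"
  and expect_minus: "cylinder f \<Longrightarrow> cylinder g \<Longrightarrow> expect (f - g) = expect f - expect g"
  by (simp_all add: expect_def pointwise)

lemma expect_scale: "expect (\<lambda>\<sigma>. c * f \<sigma>) = c * expect f"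
  by (simp add: expect_def)

lemma expect_const: "expect (\<lambda>_. c) = c"
  by (simp add: expect_def equilibrium.prob_space)

lemma expect_zero [simp]: "expect 0 = 0"
  by (simp add: expect_def zero_fun_def)

lemma expect_sum: "(\<And>i. i \<in> A \<Longrightarrow> cylinder (f i)) \<Longrightarrow> expect (sum f A) = (\<Sum>i\<in>A. expect (f i))"
  by (simp add: expect_def sum_fun_apply cong: Bochner_Integration.integral_cong)

lemma expect_mono: "cylinder f \<Longrightarrow> cylinder g \<Longrightarrow> (\<And>\<sigma>. f \<sigma> \<le> g \<sigma>) \<Longrightarrow> expect f \<le> expect g"
  unfolding expect_def by (intro integral_mono) auto

lemma expect_mean_selfadjoint:
  assumes D: "finite D" and cyl: "cylinder f" "cylinder g"
  shows "expect (mean D f * g) = expect (f * mean D g)"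
proof -
  have *: "expect (mean D f * g) = expect (mean D f * mean D g)"
    if "cylinder f" "cylinder g" for f g
  proof -
    have "expect (mean D f * g) = expect (mean D (mean D f * g))"
      using that D by (intro expect_mean[symmetric] cylinder_times cylinder_mean)
    then show ?thesis using D by (simp add: mean_module mean_depends_on_compl)
  qed
  show ?thesis using *[OF cyl] *[OF cyl(2,1)] by (simp add: mult.commute)
qed

definition sqnorm :: "(config \<Rightarrow> real) \<Rightarrow> real" where
  "sqnorm f = expect (f * f)"

lemma sqnorm_mono:
  "cylinder f \<Longrightarrow> cylinder g \<Longrightarrow> (\<And>\<sigma>. \<bar>f \<sigma>\<bar> \<le> \<bar>g \<sigma>\<bar>) \<Longrightarrow> sqnorm f \<le> sqnorm g"
  unfolding sqnorm_def
  by (intro expect_mono cylinder_times) (auto simp: times_fun_apply abs_le_square_iff power2_eq_square)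

lemma sqnorm_zero [simp]: "sqnorm 0 = 0"
  by (simp add: sqnorm_def)

lemma sqnorm_nonneg: "cylinder f \<Longrightarrow> 0 \<le> sqnorm f"
  using expect_mono[of "\<lambda>_. 0" "f * f"]
  by (simp add: sqnorm_def expect_const times_fun_apply cylinder_times cylinder_const)

lemma sqnorm_scale: "sqnorm (\<lambda>\<sigma>. c * f \<sigma>) = c\<^sup>2 * sqnorm f"
  using expect_scale[of "c\<^sup>2" "f * f"]
  by (simp add: sqnorm_def times_fun_def power2_eq_square mult_ac)

definition fluct :: "site set \<Rightarrow> (config \<Rightarrow> real) \<Rightarrow> config \<Rightarrow> real" where
  "fluct D f = f - mean D f"

lemma cylinder_fluct [intro!]: "finite D \<Longrightarrow> cylinder f \<Longrightarrow> cylinder (fluct D f)"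
  by (auto simp: fluct_def)

lemma fluct_depends_on: "finite D \<Longrightarrow> depends_on F f \<Longrightarrow> depends_on F (fluct D f)"
  unfolding fluct_def by (intro depends_on_minus depends_on_mono[OF mean_depends_on]) auto

lemma fluct_module: "finite D \<Longrightarrow> depends_on (- D) h \<Longrightarrow> fluct D (h * f) = h * fluct D f"
  by (simp add: fluct_def mean_module right_diff_distrib)

lemma mean_fluct:
  "finite A \<Longrightarrow> finite B \<Longrightarrow> mean A (fluct B f) = fluct B (mean A f)"
  by (simp add: fluct_def mean_minus mean_mean Un_commute)

lemma fluct_commute:
  "finite A \<Longrightarrow> finite B \<Longrightarrow> fluct A (fluct B f) = fluct B (fluct A f)"
  by (simp add: fluct_def mean_minus mean_mean Un_commute)

lemma fluct_idem: "finite A \<Longrightarrow> fluct A (fluct A f) = fluct A f"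
  by (simp add: fluct_def mean_minus mean_mean)

lemma expect_fluct_selfadjoint:
  "finite D \<Longrightarrow> cylinder f \<Longrightarrow> cylinder g \<Longrightarrow> expect (fluct D f * g) = expect (f * fluct D g)"
  using expect_mean_selfadjoint[of D f g]
  by (simp add: fluct_def left_diff_distrib right_diff_distrib expect_minus cylinder_times cylinder_mean)

lemma expect_fluct_indep:
  assumes "finite D" "cylinder f" "cylinder g" "depends_on (- D) g"
  shows "expect (fluct D f * g) = 0"
  using assms
  by (simp add: expect_fluct_selfadjoint) (simp add: fluct_def mean_trivial)

lemma sqnorm_fluct:
  assumes "finite D" "cylinder f"
  shows "sqnorm (fluct D f) = sqnorm f - sqnorm (mean D f)"
proof -
  have "expect (mean D f * mean D f) = expect (f * mean D f)"
    using expect_mean_selfadjoint[of D f "mean D f"] assms by (simp add: mean_mean cylinder_mean)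
  moreover have "sqnorm (fluct D f) = expect (f * fluct D f)"
    using assms by (simp add: sqnorm_def expect_fluct_selfadjoint fluct_idem cylinder_fluct)
  ultimately show ?thesis
    using assms by (simp add: sqnorm_def fluct_def right_diff_distrib expect_minus cylinder_times cylinder_mean)
qed

lemma sqnorm_mean_le: "finite D \<Longrightarrow> cylinder f \<Longrightarrow> sqnorm (mean D f) \<le> sqnorm f"
  and sqnorm_fluct_le: "finite D \<Longrightarrow> cylinder f \<Longrightarrow> sqnorm (fluct D f) \<le> sqnorm f"
  using sqnorm_nonneg[of "fluct D f"] sqnorm_nonneg[of "mean D f"]
  by (simp_all add: sqnorm_fluct cylinder_fluct cylinder_mean)

lemma martingale_decomposition:
  fixes r :: "site \<Rightarrow> real"
  assumes "finite S" and r: "inj r" and f: "cylinder f"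
  shows "(\<Sum>x\<in>S. sqnorm (fluct {x} (mean {y\<in>S. r y < r x} f))) = sqnorm f - sqnorm (mean S f)"
  using assms(1)
proof (induction S rule: finite_ranking_induct[where f=r])
  case (insert x S)
  show ?case
  proof (cases "x \<in> S")
    case False
    have less: "r y < r x" if "y \<in> S" for y
      using insert(2)[OF that] False that injD[OF r, of y x] by (cases "r y = r x") auto
    have "{z\<in>insert x S. r z < r y} = {z\<in>S. r z < r y}" if "y \<in> S" for y
      using less[OF that] by auto
    moreover have "{z\<in>insert x S. r z < r x} = S" using less by auto
    moreover have "sqnorm (fluct {x} (mean S f)) = sqnorm (mean S f) - sqnorm (mean (insert x S) f)"
      using insert(1) f by (simp add: sqnorm_fluct cylinder_mean mean_mean)
    ultimately show ?thesis using insert(1,3) False by simp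
  qed (use insert in \<open>simp add: insert_absorb\<close>)
qed simp

lemma Bessel:
  assumes "finite K" "cylinder f" and g: "\<And>x. x \<in> K \<Longrightarrow> cylinder (g x)"
    and self: "\<And>x. x \<in> K \<Longrightarrow> expect (f * g x) = sqnorm (g x)"
    and orth: "\<And>x y. x \<in> K \<Longrightarrow> y \<in> K \<Longrightarrow> x \<noteq> y \<Longrightarrow> expect (g x * g y) = 0"
  shows "(\<Sum>x\<in>K. sqnorm (g x)) \<le> sqnorm f"
proof -
  let ?s = "sum g K"
  have s: "cylinder ?s" using g by auto
  have "expect (f * ?s) = (\<Sum>x\<in>K. sqnorm (g x))"
    using g assms(2) by (simp add: sum_distrib_left expect_sum cylinder_times self)
  moreover have "expect (?s * ?s) = (\<Sum>x\<in>K. sqnorm (g x))"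
  proof -
    have "expect (?s * ?s) = (\<Sum>x\<in>K. \<Sum>y\<in>K. expect (g x * g y))"
      using g by (simp add: sum_product expect_sum cylinder_times cylinder_sum)
    also have "\<dots> = (\<Sum>x\<in>K. \<Sum>y\<in>K. if y = x then sqnorm (g x) else 0)"
      by (intro sum.cong refl) (auto simp: orth sqnorm_def)
    finally show ?thesis using assms(1) by simp
  qed
  moreover have "expect ((f - ?s) * (f - ?s)) = expect (f * f) - expect (f * ?s) - expect (f * ?s) + expect (?s * ?s)"
  proof -
    have "(f - ?s) * (f - ?s) = f * f - f * ?s - f * ?s + ?s * ?s" by (simp add: algebra_simps)
    then show ?thesis using assms(2) s
      by (simp only: expect_plus expect_minus cylinder_plus cylinder_minus cylinder_times)
  qed
  moreover have "0 \<le> sqnorm (f - ?s)" using assms(2) s by (intro sqnorm_nonneg) auto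
  ultimately show ?thesis by (simp add: sqnorm_def)
qed

lemma Bessel_fluctuations:
  assumes K: "finite K" and f: "cylinder f"
    and fin: "\<And>x. x \<in> K \<Longrightarrow> finite (G x)" "\<And>x. x \<in> K \<Longrightarrow> finite (Z x)"
    and sep: "\<And>x y. x \<in> K \<Longrightarrow> y \<in> K \<Longrightarrow> x \<noteq> y \<Longrightarrow>
      x \<in> G y \<or> Z x \<subseteq> G y \<or> y \<in> G x \<or> Z y \<subseteq> G x"
  shows "(\<Sum>x\<in>K. sqnorm (fluct (Z x) (fluct {x} (mean (G x) f)))) \<le> sqnorm f"
proof (rule Bessel[OF K f])
  let ?g = "\<lambda>x. fluct (Z x) (fluct {x} (mean (G x) f))"
  show cyl: "cylinder (?g x)" if "x \<in> K" for x using fin[OF that] f by auto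
  show "expect (f * ?g x) = sqnorm (?g x)" if "x \<in> K" for x
  proof -
    note fx = fin[OF that]
    have "sqnorm (?g x) = expect (f * mean (G x) (fluct {x} (fluct (Z x) (?g x))))"
      using fx f unfolding sqnorm_def
      by (simp add: expect_fluct_selfadjoint expect_mean_selfadjoint cylinder_fluct cylinder_mean)
    also have "mean (G x) (fluct {x} (fluct (Z x) (?g x))) = ?g x"
      using fx by (simp add: fluct_idem mean_fluct mean_mean fluct_commute[of "{x}" "Z x"])
    finally show ?thesis by simp
  qed
  have orth: "expect (?g x * ?g y) = 0" if "x \<in> K" "y \<in> K" "x \<in> G y \<or> Z x \<subseteq> G y" for x y
  proof -
    have dep: "depends_on (- G y) (?g y)"
      using that(2) fin by (intro fluct_depends_on mean_depends_on_compl) auto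
    note fx = fin[OF that(1)] and fy = fin[OF that(2)]
    from that(3) show ?thesis
    proof
      assume "x \<in> G y"
      then have "depends_on (- {x}) (?g y)" by (intro depends_on_mono[OF dep]) blast
      moreover have "?g x = fluct {x} (fluct (Z x) (mean (G x) f))"
        using fx by (intro fluct_commute) simp_all
      ultimately show ?thesis using fx fy f
        by (simp add: expect_fluct_indep cylinder_fluct cylinder_mean)
    next
      assume "Z x \<subseteq> G y"
      then have "depends_on (- Z x) (?g y)" by (intro depends_on_mono[OF dep]) blast
      then show ?thesis using fx fy f
        by (simp add: expect_fluct_indep cylinder_fluct cylinder_mean)
    qed
  qed
  show "expect (?g x * ?g y) = 0" if "x \<in> K" "y \<in> K" "x \<noteq> y" for x y
    using sep[OF that] orth[OF that(1,2)] orth[OF that(2,1)] by (auto simp: mult.commute)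
qed

end

section \<open>The Poincare inequality\<close>

definition west :: "site \<Rightarrow> site" where "west x = (fst x - 1, snd x)"
definition south :: "site \<Rightarrow> site" where "south x = (fst x, snd x - 1)"

lemma south_west: "south (west x) = west (south x)"
  by (simp add: west_def south_def)

definition near :: "site \<Rightarrow> site set" where
  "near x = {west x, south x}"

definition far :: "site \<Rightarrow> site set" where
  "far x = {west (west x), west (south x), south (south x)}"

definition level :: "site \<Rightarrow> int" where
  "level x = fst x + snd x"

text \<open>The arctangent breaks ties within an antidiagonal and is small enough not to interfere with
  the order of the antidiagonals.\<close>

definition rank :: "site \<Rightarrow> real" where
  "rank x = of_int (level x) + arctan (of_int (fst x)) / 4"

lemma level_near: "y \<in> near x \<Longrightarrow> level y = level x - 1"
  and level_far: "y \<in> far x \<Longrightarrow> level y = level x - 2"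
  by (auto simp: near_def far_def level_def west_def south_def)

lemma rank_less: "level x < level y \<Longrightarrow> rank x < rank y"
proof -
  assume "level x < level y"
  then have "real_of_int (level x) + 1 \<le> of_int (level y)" by linarith
  moreover have "\<bar>arctan (of_int (fst z))\<bar> < 2" for z :: site
    using arctan_lbound[of "of_int (fst z)"] arctan_ubound[of "of_int (fst z)"] pi_less_4 by linarith
  from this[of x] this[of y] have "arctan (of_int (fst x)) / 4 < 1/2" "- (1/2) < arctan (of_int (fst y)) / 4"
    by linarith+
  ultimately show "rank x < rank y" unfolding rank_def by linarith
qed

lemma inj_rank: "inj rank"
proof (rule injI)
  fix x y assume eq: "rank x = rank y"
  have "level x = level y"
    using rank_less[of x y] rank_less[of y x] eq by linarith
  moreover from this eq have "fst x = fst y" by (simp add: rank_def arctan_eq_iff)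
  ultimately show "x = y" by (simp add: level_def prod_eq_iff)
qed

definition spin :: "site \<Rightarrow> config \<Rightarrow> real" where
  "spin x \<sigma> = of_bool (\<sigma> x)"

definition constraint :: "site \<Rightarrow> config \<Rightarrow> real" where
  "constraint x = spin (west x) * spin (south x)"

definition relaxed_constraint :: "site \<Rightarrow> config \<Rightarrow> real" where
  "relaxed_constraint x \<sigma> = of_bool (
     (\<sigma> (west x) \<or> \<sigma> (west (west x)) \<and> \<sigma> (west (south x))) \<and>
     (\<sigma> (south x) \<or> \<sigma> (west (south x)) \<and> \<sigma> (south (south x))))"

lemma spin_cases: obtains "spin x \<sigma> = 0" | "spin x \<sigma> = 1"
  by (cases "\<sigma> x") (auto simp: spin_def)

lemma depends_on_spin: "depends_on {x} (spin x)"
  by (simp add: depends_on_def spin_def)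

lemma depends_on_spin_mem: "x \<in> F \<Longrightarrow> depends_on F (spin x)"
  by (rule depends_on_mono[OF depends_on_spin]) simp

lemma cylinder_spin [intro!, simp]: "cylinder (spin x)"
  unfolding cylinder_iff by (rule exI[of _ "{x}"]) (simp add: depends_on_spin)

lemma cylinder_constraint [intro!, simp]: "cylinder (constraint x)"
  by (auto simp: constraint_def)

lemma depends_on_constraint: "depends_on (near x) (constraint x)"
  by (auto simp: constraint_def near_def intro!: depends_on_times depends_on_spin_mem)

lemma depends_on_relaxed_constraint: "depends_on (near x \<union> far x) (relaxed_constraint x)"
  unfolding depends_on_def relaxed_constraint_def by (simp add: near_def far_def)

lemma finite_near [simp]: "finite (near x)" and finite_far [simp]: "finite (far x)"
  by (simp_all add: near_def far_def)

lemma cylinder_relaxed_constraint [intro!, simp]: "cylinder (relaxed_constraint x)"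
  unfolding cylinder_iff by (rule exI[of _ "near x \<union> far x"]) (simp add: depends_on_relaxed_constraint)

lemma abs_spin_times_le: "\<bar>spin x \<sigma> * a\<bar> \<le> \<bar>a\<bar>"
  by (rule spin_cases[of x \<sigma>]) auto

context spin_bias
begin

definition opening_prob :: real where
  "opening_prob = p\<^sup>2 * (p ^ 3 - 4 * p\<^sup>2 + 3 * p + 1)"

lemma mean_relaxed_constraint:
  "mean (near x \<union> far x) (relaxed_constraint x) = (\<lambda>_. opening_prob)"
proof (cases x)
  case (Pair a b)
  have D: "near x \<union> far x = {(a - 1, b), (a, b - 1), (a - 2, b), (a - 1, b - 1), (a, b - 2)}"
    by (auto simp: Pair near_def far_def west_def south_def)
  show ?thesis unfolding D
    by (simp add: Pair mean_insert site_mean_def relaxed_constraint_def west_def south_def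
      opening_prob_def power2_eq_square power3_eq_cube algebra_simps fun_eq_iff)
qed

lemma opening_prob_le_1: "opening_prob \<le> 1"
proof -
  have "mean (near x \<union> far x) (relaxed_constraint x) undefined \<le>
      mean (near x \<union> far x) (\<lambda>_. 1) undefined" for x
    by (rule mean_mono) (simp_all add: relaxed_constraint_def)
  then show ?thesis by (simp add: mean_relaxed_constraint mean_const)
qed

lemma opening_prob_ge:
  assumes "2 / 3 \<le> p" shows "164 / 243 \<le> opening_prob"
proof -
  define r where "r = p\<^sup>2 * (p\<^sup>2 - 10 / 3 * p + 7 / 9) + 41 / 27 * p + 82 / 81"
  have "opening_prob - 164 / 243 = (p - 2 / 3) * r"
    by (simp add: opening_prob_def r_def field_simps power2_eq_square power3_eq_cube)
  moreover have "0 \<le> r"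
  proof -
    have "0 \<le> (1 - p) * (7 / 3 - p)"
      using bias_le_1 by (intro mult_nonneg_nonneg) auto
    moreover have "(1 - p) * (7 / 3 - p) = p\<^sup>2 - 10 / 3 * p + 7 / 3"
      by (simp add: field_simps power2_eq_square)
    ultimately have "- (14 / 9) \<le> p\<^sup>2 - 10 / 3 * p + 7 / 9" by linarith
    then have "p\<^sup>2 * - (14 / 9) \<le> p\<^sup>2 * (p\<^sup>2 - 10 / 3 * p + 7 / 9)"
      by (rule mult_left_mono) simp
    moreover have "p\<^sup>2 \<le> p"
      using bias_nonneg bias_le_1 by (simp add: power2_eq_square mult_left_le)
    ultimately show ?thesis using bias_nonneg bias_le_1 unfolding r_def by linarith
  qed
  ultimately have "0 \<le> opening_prob - 164 / 243" using assms by (simp add: mult_nonneg_nonneg)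
  then show ?thesis by simp
qed

lemma sqnorm_Young:
  assumes "0 < e" "cylinder f" "cylinder g"
  shows "sqnorm (f + g) \<le> (1 + e) * sqnorm f + (1 + 1 / e) * sqnorm g"
proof -
  have "expect ((f + g) * (f + g)) \<le> expect ((\<lambda>\<sigma>. (1 + e) * (f * f) \<sigma>) + (\<lambda>\<sigma>. (1 + 1 / e) * (g * g) \<sigma>))"
  proof (rule expect_mono)
    fix \<sigma>
    have "0 \<le> (e * f \<sigma> - g \<sigma>)\<^sup>2 / e" using assms(1) by simp
    also have "(e * f \<sigma> - g \<sigma>)\<^sup>2 / e = e * (f \<sigma> * f \<sigma>) + 1 / e * (g \<sigma> * g \<sigma>) - 2 * (f \<sigma> * g \<sigma>)"
      using assms(1) by (simp add: field_simps power2_eq_square)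
    finally show "((f + g) * (f + g)) \<sigma> \<le>
        ((\<lambda>\<sigma>. (1 + e) * (f * f) \<sigma>) + (\<lambda>\<sigma>. (1 + 1 / e) * (g * g) \<sigma>)) \<sigma>"
      by (simp add: pointwise algebra_simps)
  qed (use assms in auto)
  then show ?thesis
    using assms by (simp add: sqnorm_def expect_plus expect_scale cylinder_times cylinder_scale)
qed

lemma sqnorm_plus_le: "cylinder f \<Longrightarrow> cylinder g \<Longrightarrow> sqnorm (f + g) \<le> 2 * sqnorm f + 2 * sqnorm g"
  using sqnorm_Young[of 1 f g] by simp

lemma sqnorm_minus_le: "cylinder f \<Longrightarrow> cylinder g \<Longrightarrow> sqnorm (f - g) \<le> 2 * sqnorm f + 2 * sqnorm g"
  using sqnorm_plus_le[OF _ cylinder_scale, of f g "- 1"] sqnorm_scale[of "- 1" g]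
  by (simp add: plus_fun_def fun_diff_def)

lemma sqnorm_spin_times_le: "cylinder f \<Longrightarrow> sqnorm (spin x * f) \<le> sqnorm f"
  by (rule sqnorm_mono) (auto simp: times_fun_apply abs_spin_times_le)

lemma sqnorm_open_site:
  assumes p: "2 / 3 \<le> p" and a: "cylinder a" "depends_on (- {y}) a" and u: "cylinder u"
  shows "sqnorm (a * u) \<le> 6 * sqnorm (spin y * (a * u)) + 8 * sqnorm (a * fluct {y} u)"
proof -
  let ?v = "a * mean {y} u" and ?w = "a * fluct {y} u"
  have cyl: "cylinder ?v" "cylinder ?w" using a u by auto
  have v: "depends_on (- {y}) ?v" using a by (intro depends_on_times mean_depends_on_compl) auto
  have "spin y * ?v = spin y * (a * u) - spin y * ?w"
    by (simp add: fluct_def algebra_simps)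
  then have 1: "sqnorm (spin y * ?v) \<le> 2 * sqnorm (spin y * (a * u)) + 2 * sqnorm (spin y * ?w)"
    using a u cyl by (metis sqnorm_minus_le cylinder_times cylinder_spin)
  have "sqnorm (spin y * ?v) = expect ((?v * ?v) * spin y)"
    unfolding sqnorm_def by (rule arg_cong[where f=expect])
      (auto simp: fun_eq_iff times_fun_apply spin_def)
  also have "\<dots> = expect (mean {y} ((?v * ?v) * spin y))"
    using a u by (intro expect_mean[symmetric]) auto
  also have "mean {y} ((?v * ?v) * spin y) = (?v * ?v) * mean {y} (spin y)"
    by (intro mean_module depends_on_times[OF v v]) simp
  also have "mean {y} (spin y) = (\<lambda>_. p)"
    by (simp add: mean_singleton site_mean_def spin_def)
  also have "expect (?v * ?v * (\<lambda>_. p)) = p * sqnorm ?v"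
    using expect_scale[of p "?v * ?v"] by (simp add: sqnorm_def times_fun_def mult_ac)
  finally have 2: "sqnorm (spin y * ?v) = p * sqnorm ?v" .
  have 3: "2 / 3 * sqnorm ?v \<le> p * sqnorm ?v"
    using p sqnorm_nonneg[OF cyl(1)] by (rule mult_right_mono)
  have "a * u = ?v + ?w" by (simp add: fluct_def algebra_simps)
  then have 4: "sqnorm (a * u) \<le> 2 * sqnorm ?v + 2 * sqnorm ?w"
    using sqnorm_plus_le[OF cyl] by simp
  show ?thesis using 1 2 3 4 sqnorm_spin_times_le[OF cyl(2), of y] by linarith
qed

definition flip_energy :: "site \<Rightarrow> (config \<Rightarrow> real) \<Rightarrow> real" where
  "flip_energy x f = sqnorm (constraint x * fluct {x} f)"

lemma flip_energy_nonneg: "cylinder f \<Longrightarrow> 0 \<le> flip_energy x f"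
  unfolding flip_energy_def by (intro sqnorm_nonneg) auto

lemma sqnorm_constraint_fluct_fluct_le:
  assumes "x \<notin> near y" "cylinder f"
  shows "sqnorm (constraint y * fluct {y} (fluct {x} f)) \<le> flip_energy y f"
proof -
  have "depends_on (- {x}) (constraint y)"
    using assms by (intro depends_on_mono[OF depends_on_constraint]) auto
  then have "constraint y * fluct {y} (fluct {x} f) = fluct {x} (constraint y * fluct {y} f)"
    by (simp add: fluct_module fluct_commute[of "{y}" "{x}"])
  then show ?thesis
    using assms by (simp add: flip_energy_def sqnorm_fluct_le cylinder_times cylinder_fluct)
qed

lemma sqnorm_relaxed_le:
  assumes p: "2 / 3 \<le> p" and f: "cylinder f"
  shows "sqnorm (relaxed_constraint x * fluct {x} f) \<le>
    56 * (flip_energy x f + flip_energy (west x) f + flip_energy (south x) f)"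
proof -
  let ?u = "fluct {x} f"
  let ?w = "spin (west x)" and ?s = "spin (south x)"
  let ?z1 = "spin (west (west x))" and ?z2 = "spin (west (south x))" and ?z3 = "spin (south (south x))"
  have u: "cylinder ?u" using f by auto
  have dir: "west x \<noteq> x" "south x \<noteq> x" "west x \<noteq> south x" "x \<notin> near (west x)" "x \<notin> near (south x)"
    "west x \<notin> far x" "south x \<notin> far x"
    by (auto simp: west_def south_def near_def far_def prod_eq_iff)
  have fw: "sqnorm (constraint (west x) * fluct {west x} ?u) \<le> flip_energy (west x) f"
    and fs: "sqnorm (constraint (south x) * fluct {south x} ?u) \<le> flip_energy (south x) f"
    using dir f by (intro sqnorm_constraint_fluct_fluct_le; simp)+
  have T1: "sqnorm (?w * (?s * ?u)) = flip_energy x f"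
    by (simp add: flip_energy_def constraint_def mult.assoc)
  have T2: "sqnorm ((?w * ?z2 * ?z3) * ?u) \<le> 6 * flip_energy x f + 8 * flip_energy (south x) f"
  proof -
    have "sqnorm ((?w * ?z2 * ?z3) * ?u) \<le> 6 * sqnorm (?s * ((?w * ?z2 * ?z3) * ?u))
        + 8 * sqnorm ((?w * ?z2 * ?z3) * fluct {south x} ?u)"
      using dir u by (intro sqnorm_open_site p depends_on_times depends_on_spin_mem) (auto simp: far_def)
    moreover have "sqnorm (?s * ((?w * ?z2 * ?z3) * ?u)) \<le> sqnorm (constraint x * ?u)"
      by (rule sqnorm_mono) (auto intro!: u simp: times_fun_apply constraint_def spin_def)
    moreover have "sqnorm ((?w * ?z2 * ?z3) * fluct {south x} ?u)
        \<le> sqnorm (constraint (south x) * fluct {south x} ?u)"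
      by (rule sqnorm_mono) (auto intro!: u simp: times_fun_apply constraint_def spin_def)
    ultimately show ?thesis using fs by (simp add: flip_energy_def)
  qed
  have T3: "sqnorm ((?s * ?z1 * ?z2) * ?u) \<le> 6 * flip_energy x f + 8 * flip_energy (west x) f"
  proof -
    have "sqnorm ((?s * ?z1 * ?z2) * ?u) \<le> 6 * sqnorm (?w * ((?s * ?z1 * ?z2) * ?u))
        + 8 * sqnorm ((?s * ?z1 * ?z2) * fluct {west x} ?u)"
      using dir u by (intro sqnorm_open_site p depends_on_times depends_on_spin_mem) (auto simp: far_def)
    moreover have "sqnorm (?w * ((?s * ?z1 * ?z2) * ?u)) \<le> sqnorm (constraint x * ?u)"
      by (rule sqnorm_mono) (auto intro!: u simp: times_fun_apply constraint_def spin_def)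
    moreover have "sqnorm ((?s * ?z1 * ?z2) * fluct {west x} ?u)
        \<le> sqnorm (constraint (west x) * fluct {west x} ?u)"
      by (rule sqnorm_mono) (auto intro!: u simp: times_fun_apply constraint_def spin_def south_west)
    ultimately show ?thesis using fw by (simp add: flip_energy_def)
  qed
  have T4: "sqnorm ((?z1 * ?z2 * ?z3) * ?u) \<le>
      36 * flip_energy x f + 48 * flip_energy (south x) f + 8 * flip_energy (west x) f"
  proof -
    have "sqnorm ((?z1 * ?z2 * ?z3) * ?u) \<le> 6 * sqnorm (?w * ((?z1 * ?z2 * ?z3) * ?u))
        + 8 * sqnorm ((?z1 * ?z2 * ?z3) * fluct {west x} ?u)"
      using dir u by (intro sqnorm_open_site p depends_on_times depends_on_spin_mem) (auto simp: far_def)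
    moreover have "sqnorm (?w * ((?z1 * ?z2 * ?z3) * ?u)) \<le> sqnorm ((?w * ?z2 * ?z3) * ?u)"
      by (rule sqnorm_mono) (auto intro!: u simp: times_fun_apply spin_def)
    moreover have "sqnorm ((?z1 * ?z2 * ?z3) * fluct {west x} ?u)
        \<le> sqnorm (constraint (west x) * fluct {west x} ?u)"
      by (rule sqnorm_mono) (auto intro!: u simp: times_fun_apply constraint_def spin_def south_west)
    ultimately show ?thesis using fw T2 by linarith
  qed
  let ?t = "\<lambda>a. (a * ?u) * (a * ?u)"
  have "sqnorm (relaxed_constraint x * ?u) \<le>
      expect (?t (?w * ?s) + (?t (?w * ?z2 * ?z3) + (?t (?s * ?z1 * ?z2) + ?t (?z1 * ?z2 * ?z3))))"
    unfolding sqnorm_def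
    by (rule expect_mono)
      (auto intro!: u simp: pointwise relaxed_constraint_def spin_def)
  also have "\<dots> = sqnorm ((?w * ?s) * ?u) + (sqnorm ((?w * ?z2 * ?z3) * ?u)
      + (sqnorm ((?s * ?z1 * ?z2) * ?u) + sqnorm ((?z1 * ?z2 * ?z3) * ?u)))"
    unfolding sqnorm_def by (subst expect_plus, (auto intro!: u)[2])+ (rule refl)
  finally have "sqnorm (relaxed_constraint x * ?u) \<le> 49 * flip_energy x f
      + 16 * flip_energy (west x) f + 56 * flip_energy (south x) f"
    using T1 T2 T3 T4 by (simp add: mult.assoc)
  also have "\<dots> \<le> 56 * (flip_energy x f + flip_energy (west x) f + flip_energy (south x) f)"
  proof -
    have "49 * a + 16 * b + 56 * c \<le> 56 * (a + b + c)" if "0 \<le> a" "0 \<le> b" for a b c :: real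
      using that by simp
    then show ?thesis using flip_energy_nonneg[OF f] by blast
  qed
  finally show ?thesis .
qed

lemma sqnorm_block_projection_le:
  fixes x :: site
  defines "D \<equiv> near x \<union> far x"
  assumes B: "finite B" "D \<subseteq> B" and u: "cylinder u"
  shows "opening_prob\<^sup>2 * sqnorm (mean B u) \<le> 101 * sqnorm (relaxed_constraint x * u) +
    101 / 100 * (opening_prob * (1 - opening_prob)) * sqnorm (fluct D (mean (B - D) u))"
proof -
  let ?C = "relaxed_constraint x"
  define P where "P = opening_prob"
  define g where "g = mean (B - D) u"
  define h where "h = ?C - (\<lambda>_. P)"
  have D: "finite D" by (simp add: D_def)
  have g: "cylinder g" using B u by (auto simp: g_def)
  have h: "cylinder h" by (auto simp: h_def)
  have BD: "mean B v = mean D (mean (B - D) v)" for v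
    using B D by (simp add: mean_mean Un_absorb1)
  have C: "depends_on D ?C" unfolding D_def by (rule depends_on_relaxed_constraint)
  have mC: "mean D ?C = (\<lambda>_. P)" unfolding D_def P_def by (rule mean_relaxed_constraint)
  have "mean B (?C * u) = mean D (?C * g)"
    unfolding BD g_def using B D by (subst mean_module) (auto intro: depends_on_mono[OF C])
  moreover have "mean D (h * g) = mean D (h * fluct D g)"
  proof -
    have "mean D (mean D g * h) = mean D g * mean D h"
      using D by (intro mean_module mean_depends_on_compl)
    also have "mean D h = 0" using D by (simp add: h_def mean_minus mC mean_const)
    finally have "mean D (h * mean D g) = 0" by (simp add: mult.commute)
    then show ?thesis using D by (simp add: fluct_def right_diff_distrib mean_minus)
  qed
  moreover have "(\<lambda>\<sigma>. P * mean B u \<sigma>) = mean D (?C * g) - mean D (h * g)"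
  proof -
    have "mean D (?C * g) - mean D (h * g) = mean D (\<lambda>\<sigma>. P * g \<sigma>)"
    proof -
      have "?C * g - h * g = (\<lambda>\<sigma>. P * g \<sigma>)"
        by (auto simp: h_def fun_eq_iff pointwise algebra_simps)
      then show ?thesis using D by (simp flip: mean_minus)
    qed
    also have "\<dots> = (\<lambda>\<sigma>. P * mean B u \<sigma>)"
      using D by (simp add: mean_scale BD g_def)
    finally show ?thesis by simp
  qed
  ultimately have eq: "(\<lambda>\<sigma>. P * mean B u \<sigma>) = mean B (?C * u) + (\<lambda>\<sigma>. (- 1) * mean D (h * fluct D g) \<sigma>)"
    by (simp add: fun_eq_iff pointwise)
  have "P\<^sup>2 * sqnorm (mean B u) = sqnorm (\<lambda>\<sigma>. P * mean B u \<sigma>)"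
    by (simp add: sqnorm_scale)
  also have "\<dots> \<le> (1 + 100) * sqnorm (mean B (?C * u)) +
      (1 + 1 / 100) * sqnorm (\<lambda>\<sigma>. (- 1) * mean D (h * fluct D g) \<sigma>)"
    unfolding eq using B u D g h
    by (intro sqnorm_Young cylinder_scale cylinder_mean cylinder_times cylinder_fluct) simp_all
  also have "\<dots> = 101 * sqnorm (mean B (?C * u)) + 101 / 100 * sqnorm (mean D (h * fluct D g))"
    by (subst sqnorm_scale) simp
  also have "\<dots> \<le> 101 * sqnorm (?C * u) + 101 / 100 * (P * (1 - P) * sqnorm (fluct D g))"
  proof (intro add_mono mult_left_mono)
    show "sqnorm (mean B (?C * u)) \<le> sqnorm (?C * u)"
      using B u by (intro sqnorm_mean_le) auto
    have hh: "mean D (h * h) = (\<lambda>_. P * (1 - P))"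
    proof -
      have "h * h = (\<lambda>\<sigma>. (1 - 2 * P) * ?C \<sigma>) + (\<lambda>_. P * P)"
        by (auto simp: fun_eq_iff h_def pointwise relaxed_constraint_def algebra_simps)
      then show ?thesis using D
        by (simp only: mean_plus mean_scale mC mean_const) (simp add: plus_fun_def algebra_simps)
    qed
    let ?m = "mean D (fluct D g * fluct D g)"
    have "sqnorm (mean D (h * fluct D g)) \<le> expect (\<lambda>\<sigma>. P * (1 - P) * ?m \<sigma>)"
      unfolding sqnorm_def
    proof (rule expect_mono)
      show "(mean D (h * fluct D g) * mean D (h * fluct D g)) \<sigma> \<le> P * (1 - P) * ?m \<sigma>" for \<sigma>
        using mean_Cauchy_Schwarz[OF D, of h "fluct D g" \<sigma>]
        by (simp add: hh times_fun_apply power2_eq_square)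
    qed (use D g h in auto)
    also have "\<dots> = P * (1 - P) * sqnorm (fluct D g)"
      using D g by (simp add: expect_scale expect_mean sqnorm_def cylinder_times cylinder_fluct)
    finally show "sqnorm (mean D (h * fluct D g)) \<le> P * (1 - P) * sqnorm (fluct D g)" .
  qed auto
  finally show ?thesis by (simp add: P_def g_def mult.assoc)
qed

lemma Poincare_centered:
  assumes p: "2 / 3 \<le> p" and F: "finite F" "depends_on F f" and centered: "expect f = 0"
  shows "sqnorm f \<le> 1696800 * (\<Sum>x\<in>F. flip_energy x f)"
proof -
  have f: "cylinder f" using F by (auto simp: cylinder_iff)
  define S where "S = F \<union> (\<Union>x\<in>F. near x \<union> far x)"
  define B where "B x = {y\<in>S. rank y < rank x}" for x
  define D where "D x = near x \<union> far x" for x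
  define g where "g x = mean (B x - D x) (fluct {x} f)" for x
  define P where "P = opening_prob"
  have P: "164 / 243 \<le> P" "P \<le> 1"
    using opening_prob_ge[OF p] opening_prob_le_1 by (auto simp: P_def)
  have fin: "finite S" "finite (B x)" "finite (D x)" for x
    using F by (auto simp: S_def B_def D_def)
  have trivial: "fluct {x} f = 0" if "x \<notin> F" for x
  proof -
    have "mean {x} f = f" using that by (intro mean_trivial depends_on_mono[OF F(2)]) auto
    then show ?thesis by (simp add: fluct_def)
  qed
  have DB: "D x \<subseteq> B x" if "x \<in> F" for x
    using that by (auto simp: D_def B_def S_def dest: level_near level_far intro!: rank_less)
  have mean0: "mean S f = 0"
  proof -
    have "depends_on {} (mean S f)"
      using fin(1) by (intro depends_on_mono[OF mean_depends_on[OF _ F(2)]]) (auto simp: S_def)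
    then have "mean S f \<sigma> = mean S f undefined" for \<sigma> by (rule depends_onD) simp
    then obtain c where c: "mean S f = (\<lambda>_. c)" by (intro that ext)
    have "c = expect (mean S f)" by (simp add: c expect_const)
    also have "\<dots> = 0" using fin(1) f by (simp add: expect_mean centered)
    finally show ?thesis by (simp add: c zero_fun_def)
  qed
  have "(\<Sum>x\<in>F. sqnorm (mean (B x) (fluct {x} f))) = (\<Sum>x\<in>S. sqnorm (mean (B x) (fluct {x} f)))"
  proof (rule sum.mono_neutral_left)
    show "\<forall>x\<in>S - F. sqnorm (mean (B x) (fluct {x} f)) = 0"
    proof
      fix x assume "x \<in> S - F"
      then show "sqnorm (mean (B x) (fluct {x} f)) = 0"
        using fin by (simp add: trivial mean_zero)
    qed
  qed (use fin in \<open>auto simp: S_def\<close>)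
  also have "\<dots> = (\<Sum>x\<in>S. sqnorm (fluct {x} (mean (B x) f)))"
    using fin by (simp add: mean_fluct)
  also have "\<dots> = sqnorm f"
    using martingale_decomposition[OF fin(1) inj_rank f]
    by (simp add: B_def mean0)
  finally have total: "(\<Sum>x\<in>F. sqnorm (mean (B x) (fluct {x} f))) = sqnorm f" .

  have far_sum: "(\<Sum>x\<in>F. sqnorm (fluct (far x) (fluct {x} (mean (B x - D x) f)))) \<le> sqnorm f"
  proof (rule Bessel_fluctuations[OF F(1) f])
    have sep: "x \<in> B y - D y \<or> far x \<subseteq> B y - D y"
      if "x \<in> F" "y \<in> F" "rank x < rank y" for x y
    proof (cases "level x = level y")
      case True
      then have "x \<notin> D y" using level_near[of x y] level_far[of x y] by (auto simp: D_def)
      then show ?thesis using that by (auto simp: B_def S_def)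
    next
      case False
      then have "level x < level y" using rank_less[of y x] that(3) by linarith
      then have "z \<in> B y - D y" if "z \<in> far x" for z
        using that level_far[OF that] level_near[of z y] level_far[of z y] rank_less[of z y] \<open>x \<in> F\<close>
        by (auto simp: B_def D_def S_def)
      then show ?thesis by blast
    qed
    show "x \<in> B y - D y \<or> far x \<subseteq> B y - D y \<or> y \<in> B x - D x \<or> far y \<subseteq> B x - D x"
      if "x \<in> F" "y \<in> F" "x \<noteq> y" for x y
      using sep[OF that(1,2)] sep[OF that(2,1)] injD[OF inj_rank, of x y] that(3)
      by (meson linorder_less_linear)
  qed (use fin in simp_all)
  have near_sum: "(\<Sum>x\<in>F. sqnorm (fluct (near x) (fluct {x} (mean (B x - near x) f)))) \<le> sqnorm f"
  proof (rule Bessel_fluctuations[OF F(1) f])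
    have sep: "x \<in> B y - near y \<or> near x \<subseteq> B y - near y"
      if "x \<in> F" "y \<in> F" "rank x < rank y" for x y
    proof (cases "level x = level y")
      case True
      then have "x \<notin> near y" using level_near[of x y] by auto
      then show ?thesis using that by (auto simp: B_def S_def)
    next
      case False
      then have "level x < level y" using rank_less[of y x] that(3) by linarith
      then have "z \<in> B y - near y" if "z \<in> near x" for z
        using that level_near[OF that] level_near[of z y] rank_less[of z y] \<open>x \<in> F\<close>
        by (auto simp: B_def D_def S_def)
      then show ?thesis by blast
    qed
    show "x \<in> B y - near y \<or> near x \<subseteq> B y - near y \<or> y \<in> B x - near x \<or> near y \<subseteq> B x - near x"
      if "x \<in> F" "y \<in> F" "x \<noteq> y" for x y
      using sep[OF that(1,2)] sep[OF that(2,1)] injD[OF inj_rank, of x y] that(3)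
      by (meson linorder_less_linear)
  qed (use fin in simp_all)
  have split: "sqnorm (fluct (D x) (g x)) = sqnorm (fluct (far x) (fluct {x} (mean (B x - D x) f)))
      + sqnorm (fluct (near x) (fluct {x} (mean (B x - near x) f)))" if "x \<in> F" for x
  proof -
    have "far x \<inter> near x = {}" using level_near[of _ x] level_far[of _ x] by fastforce
    then have un: "far x \<union> (B x - D x) = B x - near x" using DB[OF that] by (auto simp: D_def)
    have cg: "cylinder (g x)" unfolding g_def using fin f by (intro cylinder_mean cylinder_fluct finite_Diff) simp_all
    have "fluct {x} (mean (B x - D x) f) = g x"
      using fin by (simp add: g_def mean_fluct)
    moreover have "fluct {x} (mean (B x - near x) f) = mean (far x) (g x)"
      using fin by (simp add: g_def mean_fluct mean_mean un)
    moreover have "mean (near x) (mean (far x) (g x)) = mean (D x) (g x)"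
      by (simp add: mean_mean D_def)
    ultimately show ?thesis using cg fin
      by (simp add: sqnorm_fluct cylinder_mean)
  qed
  have energy: "(\<Sum>x\<in>F. sqnorm (relaxed_constraint x * fluct {x} f)) \<le> 168 * (\<Sum>x\<in>F. flip_energy x f)"
  proof -
    have shift: "(\<Sum>x\<in>F. flip_energy (n x) f) \<le> (\<Sum>x\<in>F. flip_energy x f)" if "inj n" for n
    proof -
      have "(\<Sum>x\<in>F. flip_energy (n x) f) = (\<Sum>y\<in>n ` F. flip_energy y f)"
        using that by (simp add: sum.reindex inj_on_subset)
      also have "\<dots> = (\<Sum>y\<in>n ` F \<inter> F. flip_energy y f)"
        using F(1) by (intro sum.mono_neutral_right) (auto simp: flip_energy_def trivial)
      also have "\<dots> \<le> (\<Sum>x\<in>F. flip_energy x f)"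
        using F(1) f by (intro sum_mono2) (auto simp: flip_energy_nonneg)
      finally show ?thesis .
    qed
    have "inj west" "inj south" by (auto simp: inj_def west_def south_def prod_eq_iff)
    note shifts = shift[OF this(1)] shift[OF this(2)]
    have "(\<Sum>x\<in>F. sqnorm (relaxed_constraint x * fluct {x} f)) \<le>
        (\<Sum>x\<in>F. 56 * (flip_energy x f + flip_energy (west x) f + flip_energy (south x) f))"
      by (intro sum_mono sqnorm_relaxed_le p f)
    also have "\<dots> = 56 * (\<Sum>x\<in>F. flip_energy x f) + 56 * (\<Sum>x\<in>F. flip_energy (west x) f)
        + 56 * (\<Sum>x\<in>F. flip_energy (south x) f)"
      by (simp add: sum.distrib distrib_left flip: sum_distrib_left)
    finally show ?thesis using shifts by linarith
  qed
  have "P\<^sup>2 * sqnorm f = (\<Sum>x\<in>F. P\<^sup>2 * sqnorm (mean (B x) (fluct {x} f)))"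
    by (simp add: total flip: sum_distrib_left)
  also have "\<dots> \<le> (\<Sum>x\<in>F. 101 * sqnorm (relaxed_constraint x * fluct {x} f) +
      101 / 100 * (P * (1 - P)) * sqnorm (fluct (D x) (g x)))"
    unfolding P_def D_def g_def using fin DB f
    by (intro sum_mono sqnorm_block_projection_le) (auto simp: D_def)
  also have "\<dots> = 101 * (\<Sum>x\<in>F. sqnorm (relaxed_constraint x * fluct {x} f)) +
      101 / 100 * (P * (1 - P)) * (\<Sum>x\<in>F. sqnorm (fluct (D x) (g x)))"
    by (simp add: sum.distrib sum_distrib_left)
  also have "\<dots> \<le> 101 * (168 * (\<Sum>x\<in>F. flip_energy x f)) +
      101 / 100 * (P * (1 - P)) * (2 * sqnorm f)"
  proof (intro add_mono mult_left_mono energy)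
    show "(\<Sum>x\<in>F. sqnorm (fluct (D x) (g x))) \<le> 2 * sqnorm f"
      using far_sum near_sum by (simp add: split sum.distrib)
  qed (use P in auto)
  finally have "P\<^sup>2 * sqnorm f - 101 / 100 * (P * (1 - P)) * (2 * sqnorm f) \<le>
      16968 * (\<Sum>x\<in>F. flip_energy x f)" by simp
  also have "P\<^sup>2 * sqnorm f - 101 / 100 * (P * (1 - P)) * (2 * sqnorm f) =
      P * (302 / 100 * P - 202 / 100) * sqnorm f"
    by (simp add: field_simps power2_eq_square)
  finally have "P * (302 / 100 * P - 202 / 100) * sqnorm f \<le> 16968 * (\<Sum>x\<in>F. flip_energy x f)" .
  moreover have "1 / 100 * sqnorm f \<le> P * (302 / 100 * P - 202 / 100) * sqnorm f"
  proof (rule mult_right_mono)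
    have "164 / 243 * (1 / 60) \<le> P * (302 / 100 * P - 202 / 100)"
      using P by (intro mult_mono) auto
    then show "1 / 100 \<le> P * (302 / 100 * P - 202 / 100)" by simp
  qed (rule sqnorm_nonneg[OF f])
  ultimately show ?thesis by simp
qed

end

section \<open>Decay of the semigroup\<close>

lemma continuous_config_measurable:
  assumes "continuous_on UNIV (f :: config \<Rightarrow> real)"
  shows "f \<in> borel_measurable config_space"
proof -
  define box :: "nat \<Rightarrow> site set" where "box n = {- int n..int n} \<times> {- int n..int n}" for n
  define cut where "cut n \<sigma> x \<longleftrightarrow> x \<in> box n \<and> \<sigma> x" for n :: nat and \<sigma> :: config and x
  have "(\<lambda>\<sigma>. f (cut n \<sigma>)) \<in> borel_measurable config_space" for n
  proof (rule cylinder_measurable, unfold cylinder_iff, intro exI conjI)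
    show "finite (box n)" by (simp add: box_def)
    show "depends_on (box n) (\<lambda>\<sigma>. f (cut n \<sigma>))"
      unfolding depends_on_def by (intro allI impI arg_cong[where f=f]) (auto simp: cut_def fun_eq_iff)
  qed
  moreover have "(\<lambda>n. f (cut n \<sigma>)) \<longlonglongrightarrow> f \<sigma>" for \<sigma>
  proof -
    have "(\<lambda>n. cut n \<sigma> x) \<longlonglongrightarrow> \<sigma> x" for x
    proof (rule tendsto_eventually)
      have "x \<in> box n" if "nat (max \<bar>fst x\<bar> \<bar>snd x\<bar>) \<le> n" for n
        using that by (cases x) (auto simp: box_def)
      then show "\<forall>\<^sub>F n in sequentially. cut n \<sigma> x = \<sigma> x"
        unfolding eventually_sequentially cut_def by blast
    qed
    then have "limitin (product_topology (\<lambda>_. euclidean) UNIV) (\<lambda>n. cut n \<sigma>) \<sigma> sequentially"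
      by (simp add: limitin_componentwise)
    then have "(\<lambda>n. cut n \<sigma>) \<longlonglongrightarrow> \<sigma>" by (simp only: euclidean_product_topology limitin_canonical_iff)
    then show ?thesis by (intro continuous_on_tendsto_compose[OF assms]) auto
  qed
  ultimately show ?thesis by (rule borel_measurable_LIMSEQ_real[rotated])
qed

context spin_bias
begin

lemma integrable_bcontfun [simp, intro]: "integrable equilibrium (apply_bcontfun f)"
  for f :: "config \<Rightarrow>\<^sub>C real"
proof (rule equilibrium.integrable_const_bound[where B="norm f"])
  show "apply_bcontfun f \<in> borel_measurable equilibrium"
    using continuous_config_measurable[of f] measurable_cong_sets[OF sets_equilibrium refl] by auto
qed (use norm_bounded[of f] in auto)

lemma integrable_bcontfun_times [simp, intro]:
  "integrable equilibrium (\<lambda>\<sigma>. apply_bcontfun f \<sigma> * apply_bcontfun g \<sigma>)"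
  for f g :: "config \<Rightarrow>\<^sub>C real"
proof (rule equilibrium.integrable_const_bound[where B="norm f * norm g"])
  show "AE \<sigma> in equilibrium. norm (apply_bcontfun f \<sigma> * apply_bcontfun g \<sigma>) \<le> norm f * norm g"
    using norm_bounded[of f] norm_bounded[of g] by (auto simp: norm_mult intro!: mult_mono simp del: real_norm_def)
qed (use integrable_bcontfun[THEN borel_measurable_integrable] in measurable)

definition inner_eq :: "(config \<Rightarrow>\<^sub>C real) \<Rightarrow> (config \<Rightarrow>\<^sub>C real) \<Rightarrow> real" where
  "inner_eq f g = (\<integral>\<sigma>. apply_bcontfun f \<sigma> * apply_bcontfun g \<sigma> \<partial>equilibrium)"

lemma bounded_bilinear_inner_eq: "bounded_bilinear inner_eq"
proof
  fix a b c :: "config \<Rightarrow>\<^sub>C real" and r :: real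
  show "inner_eq (a + b) c = inner_eq a c + inner_eq b c"
    by (simp add: inner_eq_def plus_bcontfun.rep_eq distrib_right)
  show "inner_eq a (b + c) = inner_eq a b + inner_eq a c"
    by (simp add: inner_eq_def plus_bcontfun.rep_eq distrib_left)
  show "inner_eq (r *\<^sub>R a) b = r *\<^sub>R inner_eq a b" "inner_eq a (r *\<^sub>R b) = r *\<^sub>R inner_eq a b"
    by (simp_all add: inner_eq_def scaleR_bcontfun.rep_eq mult.assoc mult.left_commute)
  have "norm (inner_eq f g) \<le> norm f * norm g * 1" for f g
  proof -
    have "\<bar>apply_bcontfun f \<sigma> * apply_bcontfun g \<sigma>\<bar> \<le> norm f * norm g" for \<sigma>
      using norm_bounded[of f \<sigma>] norm_bounded[of g \<sigma>] by (simp add: abs_mult mult_mono)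
    then have "(\<integral>\<sigma>. \<bar>apply_bcontfun f \<sigma> * apply_bcontfun g \<sigma>\<bar> \<partial>equilibrium) \<le> (\<integral>\<sigma>. norm f * norm g \<partial>equilibrium)"
      by (intro integral_mono integrable_abs) auto
    also have "\<dots> = norm f * norm g" by (simp add: equilibrium.prob_space)
    finally show ?thesis
      using integral_abs_bound[of equilibrium "\<lambda>\<sigma>. apply_bcontfun f \<sigma> * apply_bcontfun g \<sigma>"]
      unfolding inner_eq_def real_norm_def by linarith
  qed
  then show "\<exists>K. \<forall>a b. norm (inner_eq a b) \<le> norm a * norm b * K" by blast
qed

interpretation inner_eq: bounded_bilinear inner_eq
  by (rule bounded_bilinear_inner_eq)

lemma inner_eq_commute: "inner_eq f g = inner_eq g f"
  by (simp add: inner_eq_def mult.commute)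

lemma inner_eq_self_nonneg: "0 \<le> inner_eq f f"
  unfolding inner_eq_def by (intro Bochner_Integration.integral_nonneg) simp

abbreviation unit_fun :: "config \<Rightarrow>\<^sub>C real" where
  "unit_fun \<equiv> const_bcontfun 1"

lemma inner_unit: "inner_eq f unit_fun = (\<integral>\<sigma>. apply_bcontfun f \<sigma> \<partial>equilibrium)"
  by (simp add: inner_eq_def const_bcontfun.rep_eq)

lemma inner_unit_unit [simp]: "inner_eq unit_fun unit_fun = 1"
  by (simp add: inner_unit const_bcontfun.rep_eq equilibrium.prob_space)

definition variance_eq :: "(config \<Rightarrow>\<^sub>C real) \<Rightarrow> real" where
  "variance_eq f = inner_eq f f - (inner_eq f unit_fun)\<^sup>2"

lemma variance_eq_eq:
  "variance_eq f = inner_eq (f - inner_eq f unit_fun *\<^sub>R unit_fun) (f - inner_eq f unit_fun *\<^sub>R unit_fun)"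
  by (simp add: variance_eq_def inner_eq.diff_left inner_eq.diff_right inner_eq.scaleR_left
    inner_eq.scaleR_right inner_eq_commute[of unit_fun f] power2_eq_square)

lemma flip_gradient_eq: "flip_gradient p x f \<sigma> = - fluct {x} f \<sigma>"
proof (cases "\<sigma> x")
  case True
  then have "\<sigma>(x := True) = \<sigma>" by (intro fun_upd_idem) simp
  then show ?thesis using True
    by (simp add: flip_gradient_def fluct_def minus_apply mean_singleton site_mean_def algebra_simps)
next
  case False
  then have "\<sigma>(x := False) = \<sigma>" by (intro fun_upd_idem) simp
  then show ?thesis using False
    by (simp add: flip_gradient_def fluct_def minus_apply mean_singleton site_mean_def algebra_simps)
qed

lemma constraint_eq_indicator: "constraint x \<sigma> = indicator (allowed_sites \<sigma>) x"
  by (cases x) (auto simp: constraint_def times_fun_apply spin_def allowed_sites_def west_def south_def indicator_def)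

lemma pregenerator_eq_sum:
  assumes F: "finite F" "depends_on F f"
  shows "northeast_pregenerator p f = - (\<Sum>x\<in>F. constraint x * fluct {x} f)"
proof
  fix \<sigma>
  have "mean {x} f = f" if "x \<notin> F" for x
    using that by (intro mean_trivial depends_on_mono[OF F(2)]) auto
  then have "northeast_pregenerator p f \<sigma> = infsum (\<lambda>x. flip_gradient p x f \<sigma> * indicator (allowed_sites \<sigma>) x) F"
    unfolding northeast_pregenerator_def
    by (intro infsum_cong_neutral) (auto simp: flip_gradient_eq fluct_def pointwise)
  also have "\<dots> = - (\<Sum>x\<in>F. constraint x * fluct {x} f) \<sigma>"
    using F(1) by (simp add: flip_gradient_eq sum_fun_apply times_fun_apply sum_negf
      constraint_eq_indicator[symmetric] mult.commute del: sum_mult_indicator)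
  finally show "northeast_pregenerator p f \<sigma> = (- (\<Sum>x\<in>F. constraint x * fluct {x} f)) \<sigma>" by simp
qed

lemma cylinder_pregenerator: "cylinder f \<Longrightarrow> cylinder (northeast_pregenerator p f)"
proof -
  assume f: "cylinder f"
  then obtain F where F: "finite F" "depends_on F f" by (auto simp: cylinder_iff)
  have "cylinder (0 - (\<Sum>x\<in>F. constraint x * fluct {x} f))"
    by (intro cylinder_minus cylinder_zero cylinder_sum cylinder_times cylinder_constraint cylinder_fluct f) simp
  then show ?thesis using pregenerator_eq_sum[OF F] by simp
qed

lemma constraint_module: "fluct {x} (constraint x * f) = constraint x * fluct {x} f"
  by (intro fluct_module depends_on_mono[OF depends_on_constraint])
    (auto simp: near_def west_def south_def prod_eq_iff)

lemma expect_constraint_fluct: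
  assumes "cylinder f"
  shows "expect (constraint x * fluct {x} f) = 0"
    and "expect (f * (constraint x * fluct {x} f)) = flip_energy x f"
proof -
  have one: "h * (\<lambda>_. 1) = h" for h :: "config \<Rightarrow> real"
    by (simp add: fun_eq_iff times_fun_apply)
  have "expect (fluct {x} (constraint x * f) * (\<lambda>_. 1)) = 0"
    using assms by (intro expect_fluct_indep depends_on_const) auto
  then show "expect (constraint x * fluct {x} f) = 0"
    by (simp add: constraint_module one)
  have "expect (f * (constraint x * fluct {x} f)) = expect (f * fluct {x} (constraint x * fluct {x} f))"
    by (simp add: constraint_module fluct_idem)
  also have "\<dots> = expect (fluct {x} f * (constraint x * fluct {x} f))"
    using assms by (intro expect_fluct_selfadjoint[symmetric]) auto
  also have "\<dots> = flip_energy x f"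
    unfolding flip_energy_def sqnorm_def
    by (rule arg_cong[where f=expect]) (auto simp: fun_eq_iff times_fun_apply constraint_def spin_def)
  finally show "expect (f * (constraint x * fluct {x} f)) = flip_energy x f" .
qed

lemma expect_pregenerator:
  assumes F: "finite F" "depends_on F f"
  shows "expect (northeast_pregenerator p f) = 0"
    and "expect (f * northeast_pregenerator p f) = - (\<Sum>x\<in>F. flip_energy x f)"
proof -
  have f: "cylinder f" using F by (auto simp: cylinder_iff)
  have eq: "northeast_pregenerator p f = 0 - (\<Sum>x\<in>F. constraint x * fluct {x} f)"
    using pregenerator_eq_sum[OF F] by simp
  have cyl: "cylinder (\<Sum>x\<in>F. constraint x * fluct {x} f)" using f by auto
  show "expect (northeast_pregenerator p f) = 0"
    unfolding eq using cyl f
    by (subst expect_minus) (auto simp: expect_sum expect_constraint_fluct cylinder_times cylinder_fluct)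
  have "expect (f * northeast_pregenerator p f) = expect (0 - (\<Sum>x\<in>F. f * (constraint x * fluct {x} f)))"
    unfolding eq by (simp add: right_diff_distrib sum_distrib_left)
  also have "\<dots> = - (\<Sum>x\<in>F. flip_energy x f)"
    using f by (subst expect_minus)
      (auto simp: expect_sum expect_constraint_fluct cylinder_times cylinder_fluct)
  finally show "expect (f * northeast_pregenerator p f) = - (\<Sum>x\<in>F. flip_energy x f)" .
qed

lemma fluct_shift:
  assumes "finite D" shows "fluct D (f - (\<lambda>_. c)) = fluct D f"
  using assms by (simp add: fluct_def mean_minus mean_const)

lemma Poincare:
  assumes p: "2 / 3 \<le> p" and F: "finite F" "depends_on F f"
  shows "expect (f * f) - (expect f)\<^sup>2 \<le> 1696800 * (\<Sum>x\<in>F. flip_energy x f)"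
proof -
  have f: "cylinder f" using F by (auto simp: cylinder_iff)
  define c where "c = expect f"
  let ?h = "f - (\<lambda>_. c)"
  have "(\<Sum>x\<in>F. flip_energy x ?h) = (\<Sum>x\<in>F. flip_energy x f)"
    by (simp add: flip_energy_def fluct_shift)
  moreover have "expect ?h = 0"
    using f by (simp add: expect_minus expect_const cylinder_const c_def)
  moreover have "sqnorm ?h = expect (f * f) - (expect f)\<^sup>2"
  proof -
    have "?h * ?h = f * f - (\<lambda>\<sigma>. 2 * c * f \<sigma>) + (\<lambda>_. c * c)"
      by (auto simp: fun_eq_iff pointwise algebra_simps)
    then have "sqnorm ?h = expect (f * f - (\<lambda>\<sigma>. 2 * c * f \<sigma>) + (\<lambda>_. c * c))"
      by (simp only: sqnorm_def)
    also have "\<dots> = expect (f * f) - 2 * c * c + c * c"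
      using f by (subst expect_plus expect_minus; auto simp: expect_minus expect_scale expect_const cylinder_times cylinder_scale c_def)
    finally show ?thesis by (simp add: c_def power2_eq_square)
  qed
  ultimately show ?thesis
    using Poincare_centered[OF p F(1), of ?h] F(2) by (simp add: depends_on_minus depends_on_const)
qed

lemma generator_dissipation:
  assumes p: "2 / 3 \<le> p" and fg: "(f, g) \<in> closure (northeast_pregenerator_graph p)"
  shows "inner_eq g unit_fun = 0" "variance_eq f \<le> - 1696800 * inner_eq f g"
proof -
  obtain h where h: "\<And>n. h n \<in> northeast_pregenerator_graph p" and lim: "h \<longlonglongrightarrow> (f, g)"
    using fg by (auto simp: closure_sequential)
  note limits = tendsto_fst[OF lim] tendsto_snd[OF lim]
  have *: "inner_eq (snd (h n)) unit_fun = 0" "variance_eq (fst (h n)) \<le> - 1696800 * inner_eq (fst (h n)) (snd (h n))" for n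
  proof -
    obtain u v where uv: "h n = (u, v)" by (cases "h n")
    have u: "cylinder (apply_bcontfun u)" and v: "apply_bcontfun v = northeast_pregenerator p (apply_bcontfun u)"
      using h[of n] by (auto simp: northeast_pregenerator_graph_def uv)
    obtain F where F: "finite F" "depends_on F (apply_bcontfun u)" using u by (auto simp: cylinder_iff)
    have "inner_eq v unit_fun = expect (northeast_pregenerator p (apply_bcontfun u))"
      by (simp add: inner_unit expect_def v)
    then show "inner_eq (snd (h n)) unit_fun = 0" by (simp add: uv expect_pregenerator[OF F])
    have "inner_eq u v = expect (apply_bcontfun u * northeast_pregenerator p (apply_bcontfun u))"
      by (simp add: inner_eq_def expect_def v times_fun_apply)
    moreover have "variance_eq u = expect (apply_bcontfun u * apply_bcontfun u) - (expect (apply_bcontfun u))\<^sup>2"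
      by (simp add: variance_eq_def inner_unit) (simp add: inner_eq_def expect_def times_fun_apply)
    ultimately show "variance_eq (fst (h n)) \<le> - 1696800 * inner_eq (fst (h n)) (snd (h n))"
      using Poincare[OF p F] by (simp add: uv expect_pregenerator[OF F])
  qed
  have "(\<lambda>n. inner_eq (snd (h n)) unit_fun) \<longlonglongrightarrow> inner_eq (snd (f, g)) unit_fun"
    by (intro inner_eq.tendsto limits tendsto_const)
  then show "inner_eq g unit_fun = 0" by (simp add: * LIMSEQ_const_iff)
  have "(\<lambda>n. variance_eq (fst (h n))) \<longlonglongrightarrow> variance_eq (fst (f, g))"
    unfolding variance_eq_def by (intro tendsto_intros inner_eq.tendsto limits)
  moreover have "(\<lambda>n. - 1696800 * inner_eq (fst (h n)) (snd (h n))) \<longlonglongrightarrow> - 1696800 * inner_eq (fst (f, g)) (snd (f, g))"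
    by (intro tendsto_intros inner_eq.tendsto limits)
  ultimately show "variance_eq f \<le> - 1696800 * inner_eq f g"
    using LIMSEQ_le[of _ "variance_eq (fst (f, g))"] *(2) by fastforce
qed

end

locale feller =
  fixes S :: "real \<Rightarrow> (config \<Rightarrow>\<^sub>C real) \<Rightarrow> (config \<Rightarrow>\<^sub>C real)"
  assumes feller: "feller_semigroup S"
begin

lemma linear: "0 \<le> t \<Longrightarrow> linear (S t)"
  and positive: "0 \<le> t \<Longrightarrow> (\<And>\<sigma>. 0 \<le> apply_bcontfun f \<sigma>) \<Longrightarrow> 0 \<le> apply_bcontfun (S t f) \<sigma>"
  and unit: "0 \<le> t \<Longrightarrow> S t (const_bcontfun 1) = const_bcontfun 1"
  and zero_time: "S 0 f = f"
  and semigroup: "0 \<le> s \<Longrightarrow> 0 \<le> t \<Longrightarrow> S (s + t) f = S s (S t f)"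
  and strong_continuity: "((\<lambda>t. S t f) \<longlongrightarrow> f) (at_right 0)"
  using feller unfolding feller_semigroup_def by blast+

lemma contraction:
  assumes "0 \<le> t" shows "norm (S t f) \<le> norm f"
proof (rule norm_bound)
  interpret linear "S t" using assms by (rule linear)
  fix \<sigma>
  let ?c = "norm f *\<^sub>R const_bcontfun 1 :: config \<Rightarrow>\<^sub>C real"
  have c: "S t ?c = ?c" using assms by (simp add: scale unit)
  have f: "\<bar>apply_bcontfun f \<sigma>\<bar> \<le> norm f" for \<sigma> using norm_bounded[of f \<sigma>] by simp
  have "0 \<le> apply_bcontfun (?c - f) \<sigma>" "0 \<le> apply_bcontfun (?c + f) \<sigma>" for \<sigma>
    using f[of \<sigma>] by (auto simp: minus_bcontfun.rep_eq plus_bcontfun.rep_eq scaleR_bcontfun.rep_eq const_bcontfun.rep_eq)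
  then have "0 \<le> apply_bcontfun (S t (?c - f)) \<sigma>" "0 \<le> apply_bcontfun (S t (?c + f)) \<sigma>"
    using positive[OF assms] by blast+
  then show "norm (apply_bcontfun (S t f) \<sigma>) \<le> norm f"
    by (auto simp: diff add c minus_bcontfun.rep_eq plus_bcontfun.rep_eq scaleR_bcontfun.rep_eq const_bcontfun.rep_eq)
qed

lemma tendsto_semigroup:
  assumes "0 \<le> t" "(h \<longlongrightarrow> l) F"
  shows "((\<lambda>x. S t (h x)) \<longlongrightarrow> S t l) F"
proof -
  interpret bounded_linear "S t"
    using linear[OF assms(1)] contraction[OF assms(1)]
    by (auto simp: bounded_linear_def bounded_linear_axioms_def intro!: exI[of _ 1])
  show ?thesis by (rule tendsto[OF assms(2)])
qed

lemma generator_invariant: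
  assumes "0 \<le> t" "(f, g) \<in> generator_graph S"
  shows "(S t f, S t g) \<in> generator_graph S"
proof -
  interpret linear "S t" using assms(1) by (rule linear)
  have "((\<lambda>h. S t ((1 / h) *\<^sub>R (S h f - f))) \<longlongrightarrow> S t g) (at_right 0)"
    using assms by (intro tendsto_semigroup) (auto simp: generator_graph_def)
  moreover have "\<forall>\<^sub>F h in at_right 0. S t ((1 / h) *\<^sub>R (S h f - f)) = (1 / h) *\<^sub>R (S h (S t f) - S t f)"
    using eventually_at_right_less[of "0::real"]
  proof eventually_elim
    case (elim h)
    have "S t (S h f) = S h (S t f)"
      using semigroup[of t h f] semigroup[of h t f] assms(1) elim by (simp add: add.commute)
    then show ?case by (simp add: scale diff)
  qed
  ultimately show ?thesis unfolding generator_graph_def by (simp cong: tendsto_cong)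
qed

lemma has_vector_derivative_semigroup:
  assumes t: "0 < t" and fg: "(f, g) \<in> generator_graph S"
  shows "((\<lambda>s. S s f) has_vector_derivative S t g) (at t)"
  unfolding has_vector_derivative_def has_derivative_at_alt
proof (intro conjI allI impI)
  show "bounded_linear (\<lambda>x. x *\<^sub>R S t g)" by (rule bounded_linear_scaleR_left)
  fix e :: real assume "0 < e"
  define q where "q h = (1 / h) *\<^sub>R (S h f - f) - g" for h
  have "((\<lambda>h. norm (q h) + norm (S h g - g)) \<longlongrightarrow> norm (g - g) + norm (g - g)) (at_right 0)"
    unfolding q_def using fg strong_continuity[of g]
    by (intro tendsto_intros) (auto simp: generator_graph_def)
  then have "\<forall>\<^sub>F h in at_right 0. norm (q h) + norm (S h g - g) < e"
    using \<open>0 < e\<close> by (simp add: order_tendstoD)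
  then obtain d where d: "0 < d" "\<And>h. 0 < h \<Longrightarrow> h < d \<Longrightarrow> norm (q h) + norm (S h g - g) < e"
    by (auto simp: eventually_at_right_field)
  have q: "S h f - f = h *\<^sub>R (g + q h)" if "0 < h" for h
    using that by (simp add: q_def)
  show "\<exists>d>0. \<forall>y. norm (y - t) < d \<longrightarrow> norm (S y f - S t f - (y - t) *\<^sub>R S t g) \<le> e * norm (y - t)"
  proof (intro exI[of _ "min d t"] conjI allI impI)
    fix y assume y: "norm (y - t) < min d t"
    show "norm (S y f - S t f - (y - t) *\<^sub>R S t g) \<le> e * norm (y - t)"
    proof (cases y t rule: linorder_cases)
      case equal
      then show ?thesis by simp
    next
      case greater
      define h where "h = y - t"
      have h: "0 < h" "h < d" using greater y by (auto simp: h_def)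
      interpret linear "S t" using t by (intro linear) simp
      have "S y f - S t f - (y - t) *\<^sub>R S t g = S t (S h f - f - h *\<^sub>R g)"
        using semigroup[of t h f] t h by (simp add: h_def diff scale)
      also have "S h f - f - h *\<^sub>R g = h *\<^sub>R q h" using q[OF h(1)] by (simp add: scaleR_add_right)
      also have "norm (S t (h *\<^sub>R q h)) \<le> h * norm (q h)"
        using contraction[of t "h *\<^sub>R q h"] t h by simp
      also have "\<dots> \<le> h * e"
      proof (rule mult_left_mono)
        show "norm (q h) \<le> e" using d(2)[OF h] norm_ge_zero[of "S h g - g"] by linarith
      qed (use h in simp)
      finally show ?thesis using h by (simp add: h_def mult.commute)
    next
      case less
      define h where "h = t - y"
      have h: "0 < h" "h < d" "0 \<le> y" using less y by (auto simp: h_def)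
      interpret linear "S y" using h(3) by (rule linear)
      have "S t u = S y (S h u)" for u
        using semigroup[of y h u] h by (simp add: h_def)
      then have "S y f - S t f - (y - t) *\<^sub>R S t g = S y (f - S h f + h *\<^sub>R S h g)"
        by (simp add: h_def diff add scale algebra_simps)
      also have "f - S h f + h *\<^sub>R S h g = h *\<^sub>R ((S h g - g) - q h)"
        using q[OF h(1)] by (simp add: algebra_simps)
      also have "norm (S y (h *\<^sub>R ((S h g - g) - q h))) \<le> h * norm ((S h g - g) - q h)"
        using contraction[of y "h *\<^sub>R ((S h g - g) - q h)"] h by simp
      also have "\<dots> \<le> h * e"
        using d(2)[OF h(1,2)] h norm_triangle_ineq4[of "S h g - g" "q h"] by (intro mult_left_mono) auto
      finally show ?thesis using h less by (simp add: h_def mult.commute)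
    qed
  qed (use d t in auto)
qed

end

locale northeast_process = spin_bias + feller +
  assumes generator: "generator_graph S = closure (northeast_pregenerator_graph p)"
    and high_density: "2 / 3 \<le> p"
begin

definition gap :: real where "gap = 1 / 1696800"

interpretation inner_eq: bounded_bilinear inner_eq
  by (rule bounded_bilinear_inner_eq)

lemma generator_facts:
  assumes "(f, g) \<in> generator_graph S"
  shows "inner_eq g unit_fun = 0" "2 * inner_eq f g \<le> - (2 * gap) * variance_eq f"
  using generator_dissipation[of f g] high_density assms by (auto simp: generator gap_def)

lemma variance_decay:
  assumes fg: "(f, g) \<in> generator_graph S" and t: "0 < t"
  shows "inner_eq (S t f) unit_fun = inner_eq f unit_fun"
    and "variance_eq (S t f) \<le> exp (- 2 * gap * t) * variance_eq f"
proof -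
  have gen: "(S s f, S s g) \<in> generator_graph S" if "0 < s" for s
    using generator_invariant[OF _ fg] that by simp
  have deriv: "((\<lambda>s. S s f) has_vector_derivative S s g) (at s)" if "0 < s" for s
    by (rule has_vector_derivative_semigroup[OF that fg])
  have cont: "continuous_on {0..t} (\<lambda>s. S s f)"
  proof (rule continuous_on_eq_continuous_within[THEN iffD2], rule ballI)
    fix s assume s: "s \<in> {0..t}"
    show "continuous (at s within {0..t}) (\<lambda>s. S s f)"
    proof (cases "s = 0")
      case True
      have "((\<lambda>s. S s f) \<longlongrightarrow> S 0 f) (at 0 within {0..t})"
        using strong_continuity[of f] t by (simp add: zero_time at_within_Icc_at_right)
      then show ?thesis using True by (simp add: continuous_within)
    next
      case False
      with s have "0 < s" by simp
      from has_vector_derivative_continuous[OF deriv[OF this]] show ?thesis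
        by (rule continuous_at_imp_continuous_at_within)
    qed
  qed
  define m where "m s = inner_eq (S s f) unit_fun" for s
  have m_cont: "continuous_on {0..t} m"
    unfolding m_def by (intro inner_eq.continuous_on cont continuous_on_const)
  have m_deriv: "(m has_real_derivative 0) (at s)" if "0 < s" for s
    using inner_eq.has_vector_derivative[OF deriv[OF that] has_vector_derivative_const[of unit_fun]]
    by (simp add: m_def[abs_def] has_real_derivative_iff_has_vector_derivative generator_facts[OF gen[OF that]]
      inner_eq.zero_right)
  have "m t = m 0"
  proof (rule antisym)
    show "m t \<le> m 0"
      using DERIV_nonneg_imp_increasing_open[of 0 t "\<lambda>s. - m s"] t m_cont
      by (force intro!: continuous_on_minus derivative_eq_intros m_deriv)
    show "m 0 \<le> m t"
      using DERIV_nonneg_imp_increasing_open[of 0 t m] t m_cont m_deriv by force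
  qed
  then show "inner_eq (S t f) unit_fun = inner_eq f unit_fun" by (simp add: m_def zero_time)
  define v where "v s = variance_eq (S s f)" for s
  have v_eq: "v = (\<lambda>s. inner_eq (S s f) (S s f) - (m s)\<^sup>2)"
    by (simp add: v_def variance_eq_def m_def fun_eq_iff)
  have v_cont: "continuous_on {0..t} v"
    unfolding v_eq by (intro continuous_intros inner_eq.continuous_on cont m_cont)
  have v_deriv: "(v has_real_derivative 2 * inner_eq (S s f) (S s g)) (at s)" if "0 < s" for s
  proof -
    have "((\<lambda>s. inner_eq (S s f) (S s f)) has_real_derivative 2 * inner_eq (S s f) (S s g)) (at s)"
      using inner_eq.has_vector_derivative[OF deriv[OF that] deriv[OF that]]
      by (simp add: has_real_derivative_iff_has_vector_derivative inner_eq_commute[of "S s g"])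
    from DERIV_diff[OF this DERIV_power[OF m_deriv[OF that], of 2]] show ?thesis
      by (simp add: v_eq)
  qed
  define w where "w s = - (exp (2 * gap * s) * v s)" for s
  have "w 0 \<le> w t"
  proof (rule DERIV_nonneg_imp_increasing_open[where f=w])
    show "0 \<le> t" using t by simp
    show "continuous_on {0..t} w"
      unfolding w_def by (intro continuous_intros v_cont)
    fix s assume s: "0 < s" "s < t"
    define d where "d = - (2 * gap * exp (2 * gap * s) * v s
        + exp (2 * gap * s) * (2 * inner_eq (S s f) (S s g)))"
    have "(w has_real_derivative d) (at s)"
      unfolding w_def[abs_def] d_def using v_deriv[OF s(1)]
      by (auto intro!: derivative_eq_intros)
    moreover have "0 \<le> d"
    proof -
      have "0 \<le> exp (2 * gap * s) * (- (2 * gap) * v s - 2 * inner_eq (S s f) (S s g))"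
        using generator_facts(2)[OF gen[OF s(1)]] unfolding v_def by (intro mult_nonneg_nonneg) auto
      also have "\<dots> = d" unfolding d_def by (simp only: right_diff_distrib) simp
      finally show ?thesis .
    qed
    ultimately show "\<exists>y. (w has_real_derivative y) (at s) \<and> 0 \<le> y"
      by (intro exI conjI)
  qed
  then have "exp (2 * gap * t) * v t \<le> variance_eq f"
    by (simp add: w_def v_def zero_time)
  then have "exp (- 2 * gap * t) * (exp (2 * gap * t) * v t) \<le> exp (- 2 * gap * t) * variance_eq f"
    by (intro mult_left_mono) auto
  then show "variance_eq (S t f) \<le> exp (- 2 * gap * t) * variance_eq f"
    by (simp add: v_def mult.assoc[symmetric] flip: exp_add)
qed

lemma cylinder_in_domain:
  assumes "cylinder (apply_bcontfun f)"
  obtains g where "(f, g) \<in> generator_graph S"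
proof -
  define g where "g = Bcontfun (northeast_pregenerator p (apply_bcontfun f))"
  have "apply_bcontfun g = northeast_pregenerator p (apply_bcontfun f)"
    unfolding g_def by (intro Bcontfun_inverse cylinder_bcontfun cylinder_pregenerator assms)
  then have "(f, g) \<in> northeast_pregenerator_graph p"
    using assms by (simp add: northeast_pregenerator_graph_def)
  then show ?thesis using that closure_subset by (auto simp: generator)
qed

lemma correlation_decay:
  assumes f: "cylinder (apply_bcontfun f)" and t: "0 < t"
    and small: "\<And>\<sigma>. \<bar>apply_bcontfun f \<sigma>\<bar> \<le> 1" "\<And>\<sigma>. \<bar>apply_bcontfun k \<sigma>\<bar> \<le> 1"
  shows "\<bar>inner_eq k (S t f) - inner_eq k unit_fun * inner_eq f unit_fun\<bar> \<le> exp (- gap * t)"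
proof -
  obtain g where g: "(f, g) \<in> generator_graph S" using cylinder_in_domain[OF f] .
  define c where "c = inner_eq f unit_fun"
  define v where "v = S t f - c *\<^sub>R unit_fun"
  define a where "a = exp (- gap * t)"
  have a: "0 < a" by (simp add: a_def)
  have norm1: "norm f \<le> 1" "norm k \<le> 1" using small by (auto intro!: norm_bound)
  have le1: "inner_eq u u \<le> 1" if "norm u \<le> 1" for u
  proof -
    have "\<bar>apply_bcontfun u \<sigma>\<bar> \<le> 1" for \<sigma> using norm_bounded[of u \<sigma>] that by simp
    then have "apply_bcontfun u \<sigma> * apply_bcontfun u \<sigma> \<le> 1" for \<sigma>
      using abs_square_le_1[of "apply_bcontfun u \<sigma>"] by (simp add: power2_eq_square)
    then have "inner_eq u u \<le> (\<integral>\<sigma>. 1 \<partial>equilibrium)"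
      unfolding inner_eq_def by (intro integral_mono integrable_bcontfun_times) simp_all
    then show ?thesis by (simp add: equilibrium.prob_space)
  qed
  have "inner_eq v v = variance_eq (S t f)"
    using variance_decay(1)[OF g t] by (simp add: v_def c_def variance_eq_eq)
  also have "\<dots> \<le> exp (- 2 * gap * t) * variance_eq f"
    by (rule variance_decay(2)[OF g t])
  also have "\<dots> \<le> exp (- 2 * gap * t) * 1"
  proof (rule mult_left_mono)
    show "variance_eq f \<le> 1"
      using le1[OF norm1(1)] zero_le_power2[of "inner_eq f unit_fun"] unfolding variance_eq_def by linarith
  qed simp
  also have "\<dots> = a * a" by (simp add: a_def flip: exp_add)
  finally have vv: "inner_eq v v \<le> a * a" .
  have kk: "inner_eq k k \<le> 1" by (rule le1[OF norm1(2)])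
  have "2 * a * \<bar>inner_eq k v\<bar> \<le> a * a * inner_eq k k + inner_eq v v"
  proof -
    have "0 \<le> inner_eq (a *\<^sub>R k - v) (a *\<^sub>R k - v)" "0 \<le> inner_eq (a *\<^sub>R k + v) (a *\<^sub>R k + v)"
      by (rule inner_eq_self_nonneg)+
    then have "2 * a * inner_eq k v \<le> a * a * inner_eq k k + inner_eq v v"
      "- (2 * a * inner_eq k v) \<le> a * a * inner_eq k k + inner_eq v v"
      by (simp_all add: inner_eq.diff_left inner_eq.diff_right inner_eq.add_left inner_eq.add_right
        inner_eq.scaleR_left inner_eq.scaleR_right inner_eq_commute[of v k] algebra_simps)
    then show ?thesis using a by (cases "0 \<le> inner_eq k v") auto
  qed
  also have "\<dots> \<le> a * a * 1 + a * a"
    using kk vv by (intro add_mono mult_left_mono) auto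
  finally have "2 * a * \<bar>inner_eq k v\<bar> \<le> 2 * a * a" by simp
  then have "\<bar>inner_eq k v\<bar> \<le> a" using a by simp
  moreover have "inner_eq k v = inner_eq k (S t f) - inner_eq k unit_fun * inner_eq f unit_fun"
    by (simp add: v_def c_def inner_eq.diff_right inner_eq.scaleR_right mult.commute)
  ultimately show ?thesis by (simp add: a_def)
qed

end

section \<open>Two-time marginals of the process\<close>

definition pattern :: "site set \<Rightarrow> config \<Rightarrow> config \<Rightarrow>\<^sub>C real" where
  "pattern \<Lambda> \<zeta> = Bcontfun (\<lambda>\<sigma>. of_bool (\<forall>x\<in>\<Lambda>. \<sigma> x = \<zeta> x))"

lemma depends_on_pattern: "depends_on \<Lambda> (\<lambda>\<sigma>. of_bool (\<forall>x\<in>\<Lambda>. \<sigma> x = \<zeta> x) :: real)"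
  by (simp add: depends_on_def)

lemma apply_pattern: "finite \<Lambda> \<Longrightarrow> apply_bcontfun (pattern \<Lambda> \<zeta>) = (\<lambda>\<sigma>. of_bool (\<forall>x\<in>\<Lambda>. \<sigma> x = \<zeta> x))"
  unfolding pattern_def using depends_on_pattern
  by (intro Bcontfun_inverse cylinder_bcontfun) (auto simp: cylinder_iff)

lemma cylinder_pattern: "finite \<Lambda> \<Longrightarrow> cylinder (apply_bcontfun (pattern \<Lambda> \<zeta>))"
  using depends_on_pattern by (auto simp: cylinder_iff apply_pattern)

lemma restrict_eq_iff: "\<zeta> \<in> \<Lambda> \<rightarrow>\<^sub>E UNIV \<Longrightarrow> restrict \<sigma> \<Lambda> = \<zeta> \<longleftrightarrow> (\<forall>x\<in>\<Lambda>. \<sigma> x = \<zeta> x)"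
  by (auto simp: fun_eq_iff PiE_iff extensional_def restrict_def)

lemma (in spin_bias) inner_pattern_unit:
  assumes finite_window: "finite \<Lambda>" and \<zeta>: "\<zeta> \<in> \<Lambda> \<rightarrow>\<^sub>E UNIV"
  shows "inner_eq (pattern \<Lambda> \<zeta>) unit_fun = measure (bernoulli_product p \<Lambda>) {\<zeta>}"
proof -
  have sp: "space (bernoulli_product p \<Lambda>) = \<Lambda> \<rightarrow>\<^sub>E UNIV"
    by (simp add: bernoulli_product_def space_PiM)
  have "{\<zeta>} = (\<Pi>\<^sub>E x\<in>\<Lambda>. {\<zeta> x})" using \<zeta> by (auto simp: PiE_iff extensional_def fun_eq_iff)
  also have "\<dots> \<in> sets (bernoulli_product p \<Lambda>)"
    unfolding bernoulli_product_def by (rule sets_PiM_I_finite[OF finite_window]) simp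
  finally have meas: "{\<zeta>} \<in> sets (bernoulli_product p \<Lambda>)" .
  have "inner_eq (pattern \<Lambda> \<zeta>) unit_fun = expect (\<lambda>\<sigma>. of_bool (\<forall>x\<in>\<Lambda>. \<sigma> x = \<zeta> x))"
    by (simp add: inner_unit expect_def apply_pattern finite_window)
  also have "\<dots> = (\<integral>\<sigma>. of_bool (\<forall>x\<in>\<Lambda>. \<sigma> x = \<zeta> x) \<partial>bernoulli_product p \<Lambda>)"
    by (rule expect_eq_finite_product[OF finite_window depends_on_pattern])
  also have "\<dots> = (\<integral>\<sigma>. indicator {\<zeta>} \<sigma> \<partial>bernoulli_product p \<Lambda>)"
  proof (rule Bochner_Integration.integral_cong[OF refl])
    fix \<sigma> assume "\<sigma> \<in> space (bernoulli_product p \<Lambda>)"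
    then have "restrict \<sigma> \<Lambda> = \<sigma>" by (simp add: sp PiE_iff extensional_restrict)
    then show "of_bool (\<forall>x\<in>\<Lambda>. \<sigma> x = \<zeta> x) = (indicator {\<zeta>} \<sigma> :: real)"
      using restrict_eq_iff[OF \<zeta>, of \<sigma>] by (simp add: indicator_def)
  qed
  also have "\<dots> = measure (bernoulli_product p \<Lambda>) {\<zeta>}" using meas sp \<zeta> by simp
  finally show ?thesis .
qed

lemma markov_law_two_times:
  assumes Q: "markov_law S \<mu> Q" and \<mu>: "sets \<mu> = sets config_space" and t: "0 \<le> t"
  shows "(\<integral>\<omega>. apply_bcontfun k (\<omega> 0) * apply_bcontfun f (\<omega> t) \<partial>Q) =
    (\<integral>\<sigma>. apply_bcontfun k \<sigma> * apply_bcontfun (S t f) \<sigma> \<partial>\<mu>)"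
proof -
  interpret Q: prob_space Q using Q unfolding markov_law_def by blast
  have sets_Q [measurable_cong]: "sets Q = sets (path_space {0..})"
    and init: "distr Q config_space (\<lambda>\<omega>. \<omega> 0) = \<mu>"
    using Q unfolding markov_law_def by blast+
  have space_Q: "space Q = space (path_space {0..})" by (rule sets_eq_imp_space_eq[OF sets_Q])
  have coord: "(\<lambda>\<omega>. \<omega> s) \<in> Q \<rightarrow>\<^sub>M config_space" if "0 \<le> s" for s
    using that measurable_component_singleton[of s "{0..}" "\<lambda>_. config_space"]
    unfolding measurable_cong_sets[OF sets_Q refl] path_space_def by simp
  have restr: "(\<lambda>\<omega>. restrict \<omega> {0..0}) \<in> Q \<rightarrow>\<^sub>M path_space {0..0}"
    unfolding measurable_cong_sets[OF sets_Q refl] path_space_def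
    by (rule measurable_restrict_subset) auto
  have sub: "subalgebra Q (past 0)"
    unfolding subalgebra_def past_def using sets_image_in_sets[OF space_Q restr] by (simp add: space_Q)
  interpret finite_measure_subalgebra Q "past 0"
    by (simp add: finite_measure_subalgebra_def finite_measure_subalgebra_axioms_def sub Q.finite_measure_axioms)
  have cont: "apply_bcontfun u \<in> borel_measurable config_space" for u :: "config \<Rightarrow>\<^sub>C real"
    by (rule continuous_config_measurable) simp
  have past0: "(\<lambda>\<omega>. apply_bcontfun k (\<omega> 0)) \<in> borel_measurable (past 0)"
  proof -
    have "(\<lambda>\<omega>. restrict \<omega> {0..0}) \<in> past 0 \<rightarrow>\<^sub>M path_space {0..0}"
      unfolding past_def using measurable_space[OF restr]
      by (intro measurable_vimage_algebra1) (auto simp: space_Q)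
    moreover have "(\<lambda>\<omega>. \<omega> 0) \<in> path_space {0..0} \<rightarrow>\<^sub>M config_space"
      unfolding path_space_def by (rule measurable_component_singleton) simp
    ultimately have "(\<lambda>\<omega>. restrict \<omega> {0..0} 0) \<in> past 0 \<rightarrow>\<^sub>M config_space"
      by (rule measurable_compose)
    from measurable_compose[OF this cont[of k]] show ?thesis by simp
  qed
  have k: "(\<lambda>\<omega>. apply_bcontfun k (\<omega> 0)) \<in> borel_measurable Q"
    and f: "(\<lambda>\<omega>. apply_bcontfun f (\<omega> t)) \<in> borel_measurable Q"
    and Sf: "(\<lambda>\<omega>. apply_bcontfun (S t f) (\<omega> 0)) \<in> borel_measurable Q"
    using measurable_compose[OF coord cont] t by simp_all
  have int: "integrable Q (\<lambda>\<omega>. apply_bcontfun k (\<omega> 0) * apply_bcontfun f (\<omega> t))"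
  proof (rule Q.integrable_const_bound[where B="norm k * norm f"])
    show "AE \<omega> in Q. norm (apply_bcontfun k (\<omega> 0) * apply_bcontfun f (\<omega> t)) \<le> norm k * norm f"
      using norm_bounded[of k] norm_bounded[of f] by (auto simp: norm_mult intro!: mult_mono simp del: real_norm_def)
  qed (use k f in measurable)
  have "(\<integral>\<omega>. apply_bcontfun k (\<omega> 0) * apply_bcontfun f (\<omega> t) \<partial>Q) =
      (\<integral>\<omega>. apply_bcontfun k (\<omega> 0) * real_cond_exp Q (past 0) (\<lambda>\<omega>. apply_bcontfun f (\<omega> t)) \<omega> \<partial>Q)"
    by (rule real_cond_exp_intg(2)[OF int past0 f, symmetric])
  also have "\<dots> = (\<integral>\<omega>. apply_bcontfun k (\<omega> 0) * apply_bcontfun (S t f) (\<omega> 0) \<partial>Q)"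
  proof (rule integral_cong_AE)
    have "AE \<omega> in Q. real_cond_exp Q (past 0) (\<lambda>\<omega>. apply_bcontfun f (\<omega> (0 + t))) \<omega> = apply_bcontfun (S t f) (\<omega> 0)"
      using Q t unfolding markov_law_def by blast
    then show "AE \<omega> in Q. apply_bcontfun k (\<omega> 0) * real_cond_exp Q (past 0) (\<lambda>\<omega>. apply_bcontfun f (\<omega> t)) \<omega> =
        apply_bcontfun k (\<omega> 0) * apply_bcontfun (S t f) (\<omega> 0)"
      by eventually_elim simp
    show "(\<lambda>\<omega>. apply_bcontfun k (\<omega> 0) * real_cond_exp Q (past 0) (\<lambda>\<omega>. apply_bcontfun f (\<omega> t)) \<omega>) \<in> borel_measurable Q"
      using k by (intro borel_measurable_times borel_measurable_cond_exp2) 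
  qed (use k Sf in measurable)
  also have "\<dots> = (\<integral>\<sigma>. apply_bcontfun k \<sigma> * apply_bcontfun (S t f) \<sigma> \<partial>distr Q config_space (\<lambda>\<omega>. \<omega> 0))"
    by (rule integral_distr[symmetric]) (auto intro!: coord borel_measurable_times cont)
  finally show ?thesis by (simp add: init)
qed

theorem theorem3:
  fixes p :: real and \<Lambda> :: "site set"
  assumes "2 / 3 < p" and "p \<le> 1" and "finite \<Lambda>"
  shows "\<exists>C>0. \<exists>\<alpha>>0. \<forall>Q. northeast_law p (bernoulli_product p UNIV) Q \<longrightarrow>
    (\<forall>\<zeta>\<in>\<Lambda> \<rightarrow>\<^sub>E UNIV. \<forall>\<eta>\<in>\<Lambda> \<rightarrow>\<^sub>E UNIV. \<forall>t>0.
      \<bar>measure Q {\<omega> \<in> space Q. restrict (\<omega> t) \<Lambda> = \<zeta> \<and> restrict (\<omega> 0) \<Lambda> = \<eta>}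
        - measure (bernoulli_product p \<Lambda>) {\<zeta>} * measure (bernoulli_product p \<Lambda>) {\<eta>}\<bar>
      \<le> C * exp (- \<alpha> * t))"
proof (rule exI[of _ 1], rule conjI[OF zero_less_one], rule exI[of _ "1 / 1696800"], intro conjI allI impI ballI)
  fix Q and \<zeta> \<eta> :: config and t :: real
  assume law: "northeast_law p (bernoulli_product p UNIV) Q"
    and \<zeta>: "\<zeta> \<in> \<Lambda> \<rightarrow>\<^sub>E UNIV" and \<eta>: "\<eta> \<in> \<Lambda> \<rightarrow>\<^sub>E UNIV" and t: "0 < t"
  from law obtain S where S: "feller_semigroup S" "generator_graph S = closure (northeast_pregenerator_graph p)"
    and Q: "markov_law S (bernoulli_product p UNIV) Q"
    by (auto simp: northeast_law_def northeast_semigroup_def)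
  interpret northeast_process p S
    by unfold_locales (use assms S in auto)
  interpret Q: prob_space Q using Q unfolding markov_law_def by blast
  note pat = apply_pattern[OF assms(3)]
  let ?E = "{\<omega> \<in> space Q. restrict (\<omega> t) \<Lambda> = \<zeta> \<and> restrict (\<omega> 0) \<Lambda> = \<eta>}"
  have sets_Q: "sets Q = sets (path_space {0..})" using Q unfolding markov_law_def by blast
  have coord: "(\<lambda>\<omega>. apply_bcontfun f (\<omega> s)) \<in> borel_measurable Q" if "0 \<le> s" for s and f :: "config \<Rightarrow>\<^sub>C real"
    using that measurable_component_singleton[of s "{0..}" "\<lambda>_. config_space"]
    by (intro measurable_compose[OF _ continuous_config_measurable])
      (auto simp: measurable_cong_sets[OF sets_Q refl] path_space_def)
  let ?h = "\<lambda>\<omega>. apply_bcontfun (pattern \<Lambda> \<eta>) (\<omega> 0) * apply_bcontfun (pattern \<Lambda> \<zeta>) (\<omega> t)"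
  have h: "?h \<omega> = indicator ?E \<omega>" if "\<omega> \<in> space Q" for \<omega>
    using that by (simp add: pat restrict_eq_iff \<zeta> \<eta> indicator_def)
  have "?h \<in> borel_measurable Q"
    using t by (intro borel_measurable_times coord) auto
  then have "{\<omega> \<in> space Q. ?h \<omega> = 1} \<in> sets Q" by measurable
  also have "{\<omega> \<in> space Q. ?h \<omega> = 1} = ?E" using h by (auto simp: indicator_def split: if_splits)
  finally have E: "?E \<in> sets Q" .
  have "measure Q ?E = (\<integral>\<omega>. indicator ?E \<omega> \<partial>Q)" using E by simp
  also have "\<dots> = (\<integral>\<omega>. ?h \<omega> \<partial>Q)"
    by (intro Bochner_Integration.integral_cong refl) (simp add: h)
  also have "\<dots> = inner_eq (pattern \<Lambda> \<eta>) (S t (pattern \<Lambda> \<zeta>))"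
    unfolding inner_eq_def using t by (intro markov_law_two_times[OF Q sets_equilibrium]) simp
  finally have "measure Q ?E = inner_eq (pattern \<Lambda> \<eta>) (S t (pattern \<Lambda> \<zeta>))" .
  moreover have "\<bar>inner_eq (pattern \<Lambda> \<eta>) (S t (pattern \<Lambda> \<zeta>))
      - inner_eq (pattern \<Lambda> \<eta>) unit_fun * inner_eq (pattern \<Lambda> \<zeta>) unit_fun\<bar> \<le> exp (- gap * t)"
    using t by (intro correlation_decay cylinder_pattern assms(3)) (simp_all add: pat)
  ultimately show "\<bar>measure Q ?E - measure (bernoulli_product p \<Lambda>) {\<zeta>} * measure (bernoulli_product p \<Lambda>) {\<eta>}\<bar>
      \<le> 1 * exp (- (1 / 1696800) * t)"
    using inner_pattern_unit[OF assms(3) \<zeta>] inner_pattern_unit[OF assms(3) \<eta>]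
    by (simp add: gap_def mult.commute)
qed simp_all

end
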